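(* For every integer $n\ge 1$ let $\mathcal{TVA}(n)$ be the class of abelian groups generated by an $n$-state time-varying automaton over the binary alphabet $\{0,1\}$. Let $\mathcal{EA}_2(n)$ be the class of elementary abelian 2-groups of rank not greater than $n$, and let $\mathcal{AB}_2(n)$ be the class of abelian groups of rank not greater than $n$ in which the torsion part is a 2-group. Then $\mathcal{TVA}(1)=\mathcal{EA}_2(1)$, and for every $n>1$, $\mathcal{TVA}(n)=\mathcal{AB}_2(n)$.
   Context: All classes are closed under isomorphism. $\mathbb{N}=\{1,2,\ldots\}$. The rank of a finitely generated group is the minimal number of its generators (the trivial group has rank $0$); "rank not greater than $n$" thus includes being finitely generated. The trivial group counts as a 2-group and as an elementary abelian 2-group (of rank $0$); in particular torsion-free groups are allowed in $\mathcal{AB}_2(n)$. Time-varying automata. Let $X$ be a nonempty finite set (alphabet). A time-varying automaton over $X$ is a quadruple $A=(X,Q,\varphi,\psi)$, where $Q$ is a finite set (of states), $\varphi=(\varphi_i)_{i\in\mathbb{N}}$ is a sequence of functions $\varphi_i\colon Q\times X\to Q$ (transition functions) and $\psi=(\psi_i)_{i\in\mathbb{N}}$ is a sequence of functions $\psi_i\colon Q\times X\to X$ (output functions). $A$ is an $n$-state automaton if $|Q|=n$. $A$ is invertible if for all $i\in\mathbb{N}$ and $q\in Q$ the map $x\mapsto\psi_i(q,x)$ is a bijection of $X$. Group generated by an automaton. Let $X^*$ be the set of finite words over $X$ (including the empty word $\epsilon$), viewed as a rooted tree with root $\epsilon$ in which $w$ is adjacent to $wx$ for $w\in X^*$, $x\in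 X$. For $q\in Q$ and $i\in\mathbb{N}$ define $q_i\colon X^*\to X^*$ recursively by $q_i(\epsilon)=\epsilon$ and $q_i(xw)=\psi_i(q,x)\,q'_{i+1}(w)$, where $q'=\varphi_i(q,x)$, for $x\in X$, $w\in X^*$. If $A$ is invertible, each $q_i$ is an automorphism of the rooted tree $X^*$, and the group generated by $A$ is the subgroup $G(A)=\langle q_1\colon q\in Q\rangle$ of $Aut(X^* )$. An abstract group $G$ is generated by an $n$-state time-varying automaton over a $k$-letter alphabet if there is an invertible time-varying automaton $A$ with an $n$-element set of states over a $k$-letter alphabet such that $G\simeq G(A)$. The binary alphabet is $X=\{0,1\}$. *)

theory Defs
  imports "HOL-Algebra.Generated_Groups" "HOL-Algebra.Multiplicative_Group" "HOL-Algebra.Bij"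
begin

section \<open>The rooted tree of words and its automorphism group\<close>

definition word_adjacent :: "'x set \<Rightarrow> 'x list \<Rightarrow> 'x list \<Rightarrow> bool" where
  "word_adjacent X u v \<longleftrightarrow> (\<exists>x\<in>X. v = u @ [x] \<or> u = v @ [x])"

definition tree_automorphisms :: "'x set \<Rightarrow> ('x list \<Rightarrow> 'x list) set" where
  "tree_automorphisms X = {f \<in> Bij (lists X). f [] = [] \<and>
     (\<forall>u\<in>lists X. \<forall>v\<in>lists X. word_adjacent X (f u) (f v) \<longleftrightarrow> word_adjacent X u v)}"

definition tree_aut_group :: "'x set \<Rightarrow> ('x list \<Rightarrow> 'x list) monoid" where
  "tree_aut_group X = BijGroup (lists X) \<lparr>carrier := tree_automorphisms X\<rparr>"

section \<open>Time-varying automata\<close>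

text \<open>
  Transition and output functions are indexed by the positive integers; the values at index
  0, and at arguments outside the state set or the alphabet, play no role.
\<close>

record ('q, 'x) tv_automaton =
  alphabet :: "'x set"
  states :: "'q set"
  trans :: "nat \<Rightarrow> 'q \<Rightarrow> 'x \<Rightarrow> 'q"
  outp :: "nat \<Rightarrow> 'q \<Rightarrow> 'x \<Rightarrow> 'x"

locale tv_automaton =
  fixes A :: "('q, 'x) tv_automaton"
  assumes finite_alphabet: "finite (alphabet A)"
    and alphabet_nonempty: "alphabet A \<noteq> {}"
    and finite_states: "finite (states A)"
    and trans_closed: "\<And>i q x. \<lbrakk>i \<ge> 1; q \<in> states A; x \<in> alphabet A\<rbrakk> \<Longrightarrow> trans A i q x \<in> states A"
    and outp_closed: "\<And>i q x. \<lbrakk>i \<ge> 1; q \<in> states A; x \<in> alphabet A\<rbrakk> \<Longrightarrow> outp A i q x \<in> alphabet A"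

locale invertible_tv_automaton = tv_automaton +
  assumes outp_bij: "\<And>i q. \<lbrakk>i \<ge> 1; q \<in> states A\<rbrakk> \<Longrightarrow> bij_betw (outp A i q) (alphabet A) (alphabet A)"

fun state_action :: "('q, 'x) tv_automaton \<Rightarrow> nat \<Rightarrow> 'q \<Rightarrow> 'x list \<Rightarrow> 'x list" where
  "state_action A i q [] = []"
| "state_action A i q (x # w) = outp A i q x # state_action A (Suc i) (trans A i q x) w"

text \<open>
  Elements of \<^const>\<open>Bij\<close> are extensional, hence the restriction to words over the alphabet.
\<close>

definition state_aut :: "('q, 'x) tv_automaton \<Rightarrow> nat \<Rightarrow> 'q \<Rightarrow> 'x list \<Rightarrow> 'x list" where
  "state_aut A i q = restrict (state_action A i q) (lists (alphabet A))"

definition automaton_group :: "('q, 'x) tv_automaton \<Rightarrow> ('x list \<Rightarrow> 'x list) monoid" where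
  "automaton_group A = tree_aut_group (alphabet A)
     \<lparr>carrier := generate (tree_aut_group (alphabet A)) (state_aut A 1 ` states A)\<rparr>"

text \<open>
  States are taken to be natural numbers; as state sets are finite, this is no loss of generality
  (see \<open>generated_by_tv_automatonI\<close> below).
\<close>

definition generated_by_tv_automaton :: "nat \<Rightarrow> 'x set \<Rightarrow> 'a monoid \<Rightarrow> bool" where
  "generated_by_tv_automaton n X G \<longleftrightarrow>
     (\<exists>A :: (nat, 'x) tv_automaton. invertible_tv_automaton A \<and> card (states A) = n
        \<and> alphabet A = X \<and> G \<cong> automaton_group A)"

section \<open>Rank, torsion, and 2-groups\<close>

definition finitely_generated :: "'a monoid \<Rightarrow> bool" where
  "finitely_generated G \<longleftrightarrow> (\<exists>S. finite S \<and> S \<subseteq> carrier G \<and> generate G S = carrier G)"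

text \<open>Only meaningful for finitely generated groups.\<close>

definition group_rank :: "'a monoid \<Rightarrow> nat" where
  "group_rank G =
     (LEAST k. \<exists>S. finite S \<and> S \<subseteq> carrier G \<and> card S = k \<and> generate G S = carrier G)"

definition torsion_part :: "'a monoid \<Rightarrow> 'a monoid" where
  "torsion_part G =
     G \<lparr>carrier := {x \<in> carrier G. \<exists>m::nat. m > 0 \<and> x [^]\<^bsub>G\<^esub> m = \<one>\<^bsub>G\<^esub>}\<rparr>"

definition two_group :: "'a monoid \<Rightarrow> bool" where
  "two_group G \<longleftrightarrow> group G \<and> (\<forall>x\<in>carrier G. \<exists>k::nat. group.ord G x = 2 ^ k)"

definition elementary_abelian_two_group :: "'a monoid \<Rightarrow> bool" where
  "elementary_abelian_two_group G \<longleftrightarrow>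
     comm_group G \<and> (\<forall>x\<in>carrier G. x \<noteq> \<one>\<^bsub>G\<^esub> \<longrightarrow> group.ord G x = 2)"

section \<open>The three classes of groups\<close>

text \<open>
  Each class is represented by its members on an arbitrary element type; an identity between two
  of them that is polymorphic in this type is an identity of classes closed under isomorphism.
\<close>

definition TVA :: "nat \<Rightarrow> 'a monoid set" where
  "TVA n = {G. comm_group G \<and> generated_by_tv_automaton n {0, 1 :: nat} G}"

definition EA2 :: "nat \<Rightarrow> 'a monoid set" where
  "EA2 n = {G. elementary_abelian_two_group G \<and> finitely_generated G \<and> group_rank G \<le> n}"

definition AB2 :: "nat \<Rightarrow> 'a monoid set" where
  "AB2 n = {G. comm_group G \<and> finitely_generated G \<and> group_rank G \<le> n
                 \<and> two_group (torsion_part G)}"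

section \<open>Basic facts\<close>

lemma subgroup_tree_automorphisms:
  "subgroup (tree_automorphisms X) (BijGroup (lists X))"
proof (rule group.subgroupI[OF group_BijGroup])
  show "tree_automorphisms X \<subseteq> carrier (BijGroup (lists X))"
    by (auto simp: tree_automorphisms_def BijGroup_def)
  have "(\<lambda>x\<in>lists X. x) \<in> tree_automorphisms X"
    by (auto simp: tree_automorphisms_def id_Bij)
  then show "tree_automorphisms X \<noteq> {}" by blast
next
  fix f assume f: "f \<in> tree_automorphisms X"
  then have fB: "f \<in> Bij (lists X)" by (simp add: tree_automorphisms_def)
  let ?g = "inv_into (lists X) f"
  have bij: "bij_betw f (lists X) (lists X)" using fB by (simp add: Bij_def)
  have mem: "?g u \<in> lists X" if "u \<in> lists X" for u
    using Bij_inv_into_mem[OF fB that] .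
  have inv: "f (?g u) = u" if "u \<in> lists X" for u
    using bij_betw_inv_into_right[OF bij that] .
  have "?g [] = []"
    using f bij_betw_inv_into_left[OF bij, of "[]"] by (simp add: tree_automorphisms_def)
  moreover have "word_adjacent X (?g u) (?g v) \<longleftrightarrow> word_adjacent X u v"
    if "u \<in> lists X" "v \<in> lists X" for u v
  proof -
    have "word_adjacent X (f (?g u)) (f (?g v)) \<longleftrightarrow> word_adjacent X (?g u) (?g v)"
      using f mem[OF that(1)] mem[OF that(2)] unfolding tree_automorphisms_def by simp
    then show ?thesis using inv that by simp
  qed
  ultimately have "restrict ?g (lists X) \<in> tree_automorphisms X"
    using restrict_inv_into_Bij[OF fB] by (auto simp: tree_automorphisms_def)
  then show "inv\<^bsub>BijGroup (lists X)\<^esub> f \<in> tree_automorphisms X"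
    using inv_BijGroup[OF fB] by simp
next
  fix f g assume fg: "f \<in> tree_automorphisms X" "g \<in> tree_automorphisms X"
  have g: "g u \<in> lists X" if "u \<in> lists X" for u
    using fg(2) funcset_mem[OF Bij_imp_funcset that] by (simp add: tree_automorphisms_def)
  have "compose (lists X) f g \<in> tree_automorphisms X"
    using fg g unfolding tree_automorphisms_def by (simp add: compose_Bij compose_eq)
  then show "f \<otimes>\<^bsub>BijGroup (lists X)\<^esub> g \<in> tree_automorphisms X"
    using fg by (simp add: BijGroup_def tree_automorphisms_def)
qed

lemma group_tree_aut_group: "group (tree_aut_group X)"
  unfolding tree_aut_group_def
  using group.subgroup_imp_group[OF group_BijGroup subgroup_tree_automorphisms] .

lemma length_state_action [simp]: "length (state_action A i q w) = length w"
  by (induction A i q w rule: state_action.induct) auto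

lemma butlast_state_action: "butlast (state_action A i q w) = state_action A i q (butlast w)"
proof (induction A i q w rule: state_action.induct)
  case (2 A i q x w)
  show ?case
  proof (cases w)
    case (Cons y v)
    have "state_action A (Suc i) (trans A i q x) w \<noteq> []"
      by (metis Cons length_state_action length_0_conv list.distinct(1))
    then show ?thesis using 2 Cons by simp
  qed simp
qed simp

lemma word_adjacent_iff_butlast:
  assumes "u \<in> lists X" "v \<in> lists X"
  shows "word_adjacent X u v \<longleftrightarrow> v \<noteq> [] \<and> butlast v = u \<or> u \<noteq> [] \<and> butlast u = v"
proof
  show "word_adjacent X u v \<Longrightarrow> v \<noteq> [] \<and> butlast v = u \<or> u \<noteq> [] \<and> butlast u = v"
    by (auto simp: word_adjacent_def)
  assume "v \<noteq> [] \<and> butlast v = u \<or> u \<noteq> [] \<and> butlast u = v"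
  then show "word_adjacent X u v"
    unfolding word_adjacent_def
    by (metis append_butlast_last_id assms in_listsD last_in_set)
qed

context invertible_tv_automaton
begin

lemma bij_state_action:
  assumes "i \<ge> 1" "q \<in> states A"
  shows "bij_betw (state_action A i q) (lists (alphabet A)) (lists (alphabet A))"
proof -
  have closed: "state_action A i q w \<in> lists (alphabet A)"
    if "w \<in> lists (alphabet A)" "i \<ge> 1" "q \<in> states A" for i q w
    using that by (induction w arbitrary: i q) (auto simp: outp_closed trans_closed)
  have inj: "u = v" if "state_action A i q u = state_action A i q v" "i \<ge> 1" "q \<in> states A"
    "u \<in> lists (alphabet A)" "v \<in> lists (alphabet A)" for i q u v
    using that
  proof (induction u arbitrary: i q v)
    case Nil
    then show ?case by (metis length_0_conv length_state_action)
  next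
    case (Cons x u)
    then obtain y v' where v: "v = y # v'"
      by (metis length_0_conv length_state_action list.exhaust)
    have "outp A i q x = outp A i q y" "x \<in> alphabet A" "y \<in> alphabet A"
      using Cons.prems v by auto
    then have "x = y"
      using outp_bij[OF Cons.prems(2,3)] by (auto simp: bij_betw_def dest: inj_onD)
    with Cons v trans_closed show ?case by auto
  qed
  have surj: "\<exists>u\<in>lists (alphabet A). state_action A i q u = v"
    if "v \<in> lists (alphabet A)" "i \<ge> 1" "q \<in> states A" for i q v
    using that
  proof (induction v arbitrary: i q)
    case Nil
    then show ?case by (intro bexI[of _ "[]"]) auto
  next
    case (Cons y v)
    have "y \<in> outp A i q ` alphabet A"
      using outp_bij[OF Cons.prems] Cons.hyps by (simp add: bij_betw_def)
    then obtain x where x: "x \<in> alphabet A" "outp A i q x = y"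
      by blast
    moreover obtain u where "u \<in> lists (alphabet A)" "state_action A (Suc i) (trans A i q x) u = v"
      using Cons.IH[of "Suc i" "trans A i q x"] trans_closed[OF Cons.prems x(1)] by auto
    ultimately show ?case by (intro bexI[of _ "x # u"]) auto
  qed
  show ?thesis
    unfolding bij_betw_def inj_on_def
  proof (intro conjI ballI impI)
    show "state_action A i q ` lists (alphabet A) = lists (alphabet A)"
      using closed surj assms unfolding image_def by blast
  qed (use inj assms in blast)
qed

lemma state_aut_in_tree_automorphisms:
  assumes "i \<ge> 1" "q \<in> states A"
  shows "state_aut A i q \<in> tree_automorphisms (alphabet A)"
proof -
  let ?f = "state_action A i q" and ?L = "lists (alphabet A)"
  note bij = bij_state_action[OF assms]
  have mem: "?f u \<in> ?L" if "u \<in> ?L" for u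
    using bij that by (rule bij_betw_apply)
  have ne: "?f u \<noteq> [] \<longleftrightarrow> u \<noteq> []" for u
    by (metis length_0_conv length_state_action)
  have eq: "?f u = ?f v \<longleftrightarrow> u = v" if "u \<in> ?L" "v \<in> ?L" for u v
    using bij that by (auto simp: bij_betw_def dest: inj_onD)
  have bl: "butlast u \<in> ?L" if "u \<in> ?L" for u
    using that by (auto dest: in_set_butlastD)
  have "word_adjacent (alphabet A) (?f u) (?f v) \<longleftrightarrow> word_adjacent (alphabet A) u v"
    if "u \<in> ?L" "v \<in> ?L" for u v
    using that by (simp only: word_adjacent_iff_butlast mem butlast_state_action ne eq bl)
  then show ?thesis
    using bij by (auto simp: tree_automorphisms_def state_aut_def Bij_def cong: bij_betw_cong)
qed

end

lemma generated_by_tv_automatonI: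
  fixes A :: "('q, 'x) tv_automaton"
  assumes A: "invertible_tv_automaton A" and iso: "G \<cong> automaton_group A"
  shows "generated_by_tv_automaton (card (states A)) (alphabet A) G"
proof -
  interpret invertible_tv_automaton A by fact
  obtain f :: "'q \<Rightarrow> nat" where f: "inj_on f (states A)"
    using finite_imp_inj_to_nat_seg[OF finite_states] by blast
  let ?g = "inv_into (states A) f"
  define B :: "(nat, 'x) tv_automaton" where
    "B = \<lparr>alphabet = alphabet A, states = f ` states A,
          trans = \<lambda>i q x. f (trans A i (?g q) x), outp = \<lambda>i q. outp A i (?g q)\<rparr>"
  have B: "invertible_tv_automaton B"
    by unfold_locales
      (auto simp: B_def f finite_alphabet alphabet_nonempty finite_states trans_closed outp_closed
        outp_bij)
  have act: "state_action B i (f q) w = state_action A i q w"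
    if "i \<ge> 1" "q \<in> states A" "w \<in> lists (alphabet A)" for i q w
    using that by (induction w arbitrary: i q) (auto simp: B_def f trans_closed)
  have "state_aut B 1 (f q) = state_aut A 1 q" if "q \<in> states A" for q
    using act that by (auto simp: state_aut_def B_def restrict_def fun_eq_iff)
  then have "state_aut B 1 ` states B = state_aut A 1 ` states A"
    by (auto simp: B_def image_iff)
  then have "automaton_group B = automaton_group A"
    by (simp add: automaton_group_def B_def)
  moreover have "card (states B) = card (states A)" "alphabet B = alphabet A"
    using f by (simp_all add: B_def card_image)
  ultimately show ?thesis
    using B iso unfolding generated_by_tv_automaton_def by metis
qed

end

theory Submission
  imports Defs "HOL-Combinatorics.Transposition" "HOL-Library.Countable" "HOL-Number_Theory.Cong"
begin

text \<open>
  For an automorphism \<open>f\<close> of the binary tree, \<open>f\<close> to the power \<open>2 ^ k\<close> fixes all words of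
  length \<open>k\<close>, so an element of odd order is trivial. If \<open>q\<close> is the only state, its square is
  trivial.

  Conversely, let \<open>G = N 0 \<supseteq> N 1 \<supseteq> \<dots>\<close> be subgroups of an abelian group, each of index at
  most 2 in its predecessor, with trivial intersection. Choosing \<open>d i \<in> N i - N (i + 1)\<close> whenever
  the index is 2, \<open>G\<close> acts faithfully on the binary tree: \<open>g \<in> N i\<close> swaps the letters at time
  \<open>i\<close> iff \<open>g \<notin> N (i + 1)\<close>, and then has the sections \<open>g + d i\<close> and \<open>g - d i\<close>.
  This action comes from an \<open>n\<close>-state automaton if the sections of at most \<open>n\<close> generators remain
  among at most \<open>n\<close> elements at every time. Writing \<open>G\<close> as a direct sum of \<open>n\<close> cyclic groups,
  possibly trivial, generated by the \<open>e j\<close>, one passes from \<open>e j\<close> to \<open>2 e j - e l\<close> with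
  \<open>l \<noteq> j\<close>; this works if \<open>G\<close> is free on the \<open>e j\<close> or some \<open>e l\<close> is trivial. If some
  \<open>e j\<close> has finite order, starting with \<open>e i + e j\<close> in place of \<open>e j\<close> reduces to the case
  where \<open>e j\<close> is trivial.
\<close>

section \<open>Bases of finitely generated abelian groups\<close>

context comm_group
begin

section \<open>Integer combinations of a tuple\<close>

definition int_comb :: "nat \<Rightarrow> (nat \<Rightarrow> 'a) \<Rightarrow> (nat \<Rightarrow> int) \<Rightarrow> 'a" where
  "int_comb n e v = (\<Otimes>i\<in>{..<n}. e i [^] v i)"

definition int_span :: "nat \<Rightarrow> (nat \<Rightarrow> 'a) \<Rightarrow> 'a set" where
  "int_span n e = range (int_comb n e)"

text \<open>The span is then the internal direct product of the cyclic groups of the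
  \<open>e i\<close>, which may be finite or trivial. For generators of infinite order this is
  freeness.\<close>

definition independent :: "nat \<Rightarrow> (nat \<Rightarrow> 'a) \<Rightarrow> bool" where
  "independent n e \<longleftrightarrow> (\<forall>v. int_comb n e v = \<one> \<longrightarrow> (\<forall>i<n. e i [^] v i = \<one>))"

lemma int_comb_closed [simp]: "range e \<subseteq> carrier G \<Longrightarrow> int_comb n e v \<in> carrier G"
  unfolding int_comb_def by (intro finprod_closed) auto

lemma int_comb_0 [simp]: "int_comb 0 e v = \<one>"
  by (simp add: int_comb_def)

lemma int_comb_Suc:
  assumes "range e \<subseteq> carrier G"
  shows "int_comb (Suc n) e v = int_comb n e v \<otimes> e n [^] v n"
proof -
  have "e i \<in> carrier G" for i using assms by auto
  then show ?thesis
    unfolding int_comb_def lessThan_Suc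
    by (subst finprod_insert) (auto simp: m_comm)
qed

lemma int_comb_cong:
  assumes "\<And>i. i < n \<Longrightarrow> e i = e' i" "\<And>i. i < n \<Longrightarrow> v i = v' i" "range e' \<subseteq> carrier G"
  shows "int_comb n e v = int_comb n e' v'"
proof -
  have "e' i \<in> carrier G" for i using assms(3) by auto
  then show ?thesis unfolding int_comb_def using assms by (intro finprod_cong') auto
qed

lemma int_comb_add:
  assumes "range e \<subseteq> carrier G"
  shows "int_comb n e (\<lambda>i. u i + v i) = int_comb n e u \<otimes> int_comb n e v"
proof -
  have "e i \<in> carrier G" for i using assms by auto
  then have "int_comb n e (\<lambda>i. u i + v i) = (\<Otimes>i\<in>{..<n}. e i [^] u i \<otimes> e i [^] v i)"
    unfolding int_comb_def by (intro finprod_cong') (auto simp: int_pow_mult)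
  also have "\<dots> = int_comb n e u \<otimes> int_comb n e v"
    unfolding int_comb_def using \<open>\<And>i. e i \<in> carrier G\<close> by (intro finprod_multf) auto
  finally show ?thesis .
qed

lemma int_comb_scale:
  assumes "range e \<subseteq> carrier G"
  shows "int_comb n e (\<lambda>i. k * v i) = int_comb n e v [^] k"
proof (induction n)
  case (Suc n)
  have "e n \<in> carrier G" using assms by auto
  with Suc show ?case
    using assms by (simp add: int_comb_Suc int_pow_distrib int_pow_pow mult.commute)
qed simp

lemma int_comb_zero:
  assumes "\<And>i. i < n \<Longrightarrow> v i = 0"
  shows "int_comb n e v = \<one>"
  unfolding int_comb_def using assms by (intro finprod_one_eqI) auto

lemma int_comb_neg:
  assumes "range e \<subseteq> carrier G"
  shows "int_comb n e (\<lambda>i. - v i) = inv (int_comb n e v)"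
  using int_comb_scale[OF assms, of n "-1" v] assms by (simp add: int_pow_neg)

lemma int_comb_single:
  assumes "range e \<subseteq> carrier G" "j < n"
  shows "int_comb n e ((\<lambda>_. 0)(j := k)) = e j [^] k"
  using \<open>j < n\<close>
proof (induction n)
  case (Suc n)
  have "e i \<in> carrier G" for i using assms by auto
  then show ?case
    using Suc assms(1) int_comb_zero[of n "(\<lambda>_. 0)(n := k)" e]
    by (cases "j = n") (simp_all add: int_comb_Suc del: fun_upd_apply, simp_all)
qed simp

lemma int_comb_unit:
  assumes "range e \<subseteq> carrier G" "j < n"
  shows "int_comb n e ((\<lambda>_. 0)(j := 1)) = e j"
proof -
  have "e j \<in> carrier G" using assms by auto
  then show ?thesis using int_comb_single[OF assms] by simp
qed

lemma int_comb_fun_upd: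
  assumes e: "range e \<subseteq> carrier G" and j: "j < n" and x: "x \<in> carrier G"
  shows "int_comb n (e(j := x)) v = int_comb n e (v(j := 0)) \<otimes> x [^] v j"
proof -
  let ?e = "e(j := x)"
  have e': "range ?e \<subseteq> carrier G" using e x by auto
  have "int_comb n ?e v = int_comb n ?e (\<lambda>i. (v(j := 0)) i + ((\<lambda>_. 0)(j := v j)) i)"
    by (intro int_comb_cong) (use e' in auto)
  also have "\<dots> = int_comb n ?e (v(j := 0)) \<otimes> int_comb n ?e ((\<lambda>_. 0)(j := v j))"
    by (rule int_comb_add[OF e'])
  also have "int_comb n ?e (v(j := 0)) = int_comb n e (v(j := 0))"
  proof -
    have "e i \<in> carrier G" "?e i \<in> carrier G" for i using e e' by auto
    then show ?thesis unfolding int_comb_def by (intro finprod_cong') auto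
  qed
  finally show ?thesis using int_comb_single[OF e' j] by (simp only: fun_upd_same)
qed

text \<open>A change of one generator becomes a linear substitution of exponents, from which spans
  and relations of the new tuple can be read off.\<close>

lemma int_comb_fun_upd_comb:
  assumes e: "range e \<subseteq> carrier G" and j: "j < n"
  shows "int_comb n (e(j := int_comb n e b)) v = int_comb n e (\<lambda>i. (v(j := 0)) i + v j * b i)"
  using int_comb_fun_upd[OF e j int_comb_closed[OF e]]
  by (simp only: int_comb_add[OF e] int_comb_scale[OF e])

lemma range_transpose_subset: "range (e \<circ> transpose i j) = range e"
  by (metis surj_transpose image_comp)

lemma int_comb_transpose:
  assumes e: "range e \<subseteq> carrier G" and "i < n" "j < n"
  shows "int_comb n (e \<circ> transpose i j) (v \<circ> transpose i j) = int_comb n e v"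
proof -
  have 1: "transpose i j ` {..<n} = {..<n}"
    using assms by (simp add: transpose_image_eq)
  have "e i \<in> carrier G" for i using e by auto
  then have "(\<Otimes>i\<in>transpose i j ` {..<n}. e i [^] v i) = int_comb n (e \<circ> transpose i j) (v \<circ> transpose i j)"
    unfolding int_comb_def by (subst finprod_reindex) auto
  then show ?thesis by (simp add: 1 int_comb_def)
qed

section \<open>Spans and changes of generators\<close>

lemma int_comb_in_span [simp]: "int_comb n e v \<in> int_span n e"
  by (simp add: int_span_def)

lemma int_span_closed: "range e \<subseteq> carrier G \<Longrightarrow> int_span n e \<subseteq> carrier G"
  by (auto simp: int_span_def)

lemma subgroup_int_span:
  assumes "range e \<subseteq> carrier G"
  shows "subgroup (int_span n e) G"
proof (rule subgroupI)
  show "inv a \<in> int_span n e" if "a \<in> int_span n e" for a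
    using that int_comb_neg[OF assms, symmetric] by (auto simp: int_span_def)
  show "a \<otimes> b \<in> int_span n e" if "a \<in> int_span n e" "b \<in> int_span n e" for a b
    using that int_comb_add[OF assms, symmetric] by (auto simp: int_span_def)
qed (use assms in \<open>auto simp: int_span_def\<close>)

lemma int_span_incl:
  assumes "range e \<subseteq> carrier G" "i < n"
  shows "e i \<in> int_span n e"
  unfolding int_span_def by (metis int_comb_unit[OF assms] rangeI)

lemma int_comb_in_subgroup:
  assumes "subgroup H G" "\<And>i. i < n \<Longrightarrow> e i \<in> H" "range e \<subseteq> carrier G"
  shows "int_comb n e v \<in> H"
  using assms(2)
proof (induction n)
  case 0
  then show ?case using assms(1) by (simp add: subgroup.one_closed)
next
  case (Suc n)
  then show ?case
    using assms by (simp add: int_comb_Suc subgroup.m_closed subgroup_int_pow_closed)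
qed

lemma int_span_least:
  assumes "subgroup H G" "\<And>i. i < n \<Longrightarrow> e i \<in> H" "range e \<subseteq> carrier G"
  shows "int_span n e \<subseteq> H"
  using int_comb_in_subgroup[OF assms] by (auto simp: int_span_def)

lemma generate_eq_int_span:
  assumes "range e \<subseteq> carrier G"
  shows "generate G (e ` {..<n}) = int_span n e"
proof
  show "generate G (e ` {..<n}) \<subseteq> int_span n e"
    using assms int_span_incl by (intro generate_subgroup_incl subgroup_int_span) auto
  show "int_span n e \<subseteq> generate G (e ` {..<n})"
    using assms by (intro int_span_least generate_is_subgroup) (auto intro: generate.incl)
qed

lemma int_span_mono:
  assumes "range e \<subseteq> carrier G" "range e' \<subseteq> carrier G" "\<And>i. i < n \<Longrightarrow> e i \<in> int_span m e'"
  shows "int_span n e \<subseteq> int_span m e'"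
  using assms by (intro int_span_least subgroup_int_span) auto

text \<open>An elementary operation: \<open>a\<close> involves only the first \<open>n\<close>
  entries, which do not change, so it lies in both spans and multiplication by \<open>inv a\<close>
  undoes the operation.\<close>

lemma int_span_fun_upd_mult:
  assumes e: "range e \<subseteq> carrier G" and a: "a \<in> int_span n e"
  shows "int_span (Suc n) (e(n := e n \<otimes> a)) = int_span (Suc n) e"
proof -
  let ?e = "e(n := e n \<otimes> a)"
  have aG: "a \<in> carrier G" using a int_span_closed[OF e] by auto
  have enG: "e n \<in> carrier G" using e by auto
  have e': "range ?e \<subseteq> carrier G" using e aG enG by auto
  have 1: "a \<in> int_span (Suc n) f" if f: "range f \<subseteq> carrier G" "\<And>i. i < n \<Longrightarrow> f i = e i" for f
  proof -
    obtain v where v: "a = int_comb n e v" using a by (auto simp: int_span_def)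
    have "a = int_comb n f v" unfolding v by (rule int_comb_cong) (use f in auto)
    also have "\<dots> \<in> int_span (Suc n) f"
      using f(1) by (intro int_comb_in_subgroup subgroup_int_span int_span_incl) auto
    finally show ?thesis .
  qed
  show ?thesis
  proof
    have "?e i \<in> int_span (Suc n) e" if "i < Suc n" for i
      using that e 1[OF e] int_span_incl[OF e] subgroup.m_closed[OF subgroup_int_span[OF e]] by auto
    then show "int_span (Suc n) ?e \<subseteq> int_span (Suc n) e" using e e' by (intro int_span_mono)
    have "e i \<in> int_span (Suc n) ?e" if "i < Suc n" for i
    proof (cases "i = n")
      case True
      have "?e n \<otimes> inv a \<in> int_span (Suc n) ?e"
        using 1[of ?e] e' int_span_incl[OF e', of n "Suc n"]
        by (intro subgroup.m_closed[OF subgroup_int_span[OF e']]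
            subgroup.m_inv_closed[OF subgroup_int_span[OF e']]) auto
      then show ?thesis using True aG enG by (simp add: m_assoc)
    next
      case False
      then show ?thesis using int_span_incl[OF e' that] by simp
    qed
    then show "int_span (Suc n) e \<subseteq> int_span (Suc n) ?e" using e e' by (intro int_span_mono)
  qed
qed

lemma int_span_transpose:
  assumes e: "range e \<subseteq> carrier G" and "i < n" "j < n"
  shows "int_span n (e \<circ> transpose i j) = int_span n e"
proof
  have *: "transpose i j k < n" if "k < n" for k
    using that assms by (auto simp: transpose_def)
  show "int_span n (e \<circ> transpose i j) \<subseteq> int_span n e"
    using e * by (intro int_span_mono) (auto simp: range_transpose_subset intro: int_span_incl)
  have "e k \<in> int_span n (e \<circ> transpose i j)" if "k < n" for k
    using int_span_incl[of "e \<circ> transpose i j", OF _ *[OF that]] e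
    by (simp only: range_transpose_subset o_apply transpose_involutory)
  then show "int_span n e \<subseteq> int_span n (e \<circ> transpose i j)"
    using e by (intro int_span_mono) (auto simp: range_transpose_subset)
qed

lemma int_span_Suc_cong:
  assumes "range e \<subseteq> carrier G" "range e' \<subseteq> carrier G" "int_span n e = int_span n e'" "e n = e' n"
  shows "int_span (Suc n) e = int_span (Suc n) e'"
proof -
  have *: "int_span (Suc n) f = (\<lambda>(a, k). a \<otimes> f n [^] k) ` (int_span n f \<times> (UNIV :: int set))"
    if f: "range f \<subseteq> carrier G" for f
  proof (intro equalityI subsetI)
    fix x assume "x \<in> int_span (Suc n) f"
    then show "x \<in> (\<lambda>(a, k). a \<otimes> f n [^] k) ` (int_span n f \<times> (UNIV :: int set))"
      using f by (force simp: int_span_def int_comb_Suc)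
  next
    fix x assume "x \<in> (\<lambda>(a, k). a \<otimes> f n [^] k) ` (int_span n f \<times> (UNIV :: int set))"
    then obtain v and k :: int where "x = int_comb n f v \<otimes> f n [^] k" by (auto simp: int_span_def)
    then have "x = int_comb (Suc n) f (v(n := k))"
      using f int_comb_cong[of n f f "v(n := k)" v] by (simp add: int_comb_Suc)
    then show "x \<in> int_span (Suc n) f" by (auto simp: int_span_def)
  qed
  show ?thesis using assms by (simp add: *)
qed

section \<open>Existence of an independent generating tuple\<close>

text \<open>
  Among all generating tuples and all their relations, take the least positive coefficient \<open>k\<close>.
  By minimality \<open>k\<close> divides the other coefficients of its relation, so the generator carrying it
  can be modified to have order \<open>k\<close>, and minimality again splits it off as a direct factor.
\<close>

lemma independent_basis_exists:
  assumes "range f \<subseteq> carrier G"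
  shows "\<exists>e. range e \<subseteq> carrier G \<and> int_span n e = int_span n f \<and> independent n e"
  using assms
proof (induction n arbitrary: f)
  case 0
  then show ?case by (auto simp: independent_def)
next
  case (Suc n)
  note f = \<open>range f \<subseteq> carrier G\<close>
  define T where "T = {e. range e \<subseteq> carrier G \<and> int_span (Suc n) e = int_span (Suc n) f}"
  \<comment> \<open>\<open>K\<close> looks only at position \<open>n\<close>; since
    \<open>move\<close> transposes any position there, \<open>K\<close> collects all positive
    coefficients of relations.\<close>
  define K where "K = {k::nat. 0 < k \<and> (\<exists>e\<in>T. \<exists>v. int_comb (Suc n) e v = \<one> \<and> v n = int k)}"
  have move: "\<exists>e'\<in>T. \<exists>v'. int_comb (Suc n) e' v' = \<one> \<and> v' n = v i"
    if "e \<in> T" "int_comb (Suc n) e v = \<one>" "i < Suc n" for e v i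
  proof (intro bexI exI conjI)
    have e: "range e \<subseteq> carrier G" using that by (simp add: T_def)
    show "int_comb (Suc n) (e \<circ> transpose i n) (v \<circ> transpose i n) = \<one>"
      using int_comb_transpose[OF e] that by simp
    show "e \<circ> transpose i n \<in> T"
      using e that int_span_transpose[OF e, of i "Suc n" n] unfolding T_def
      by (simp only: mem_Collect_eq range_transpose_subset)
  qed simp
  show ?case
  proof (cases "K = {}")
    case True
    \<comment> \<open>A nonzero coefficient, made positive by multiplying the relation by its sign,
      would be an element of \<open>K\<close>.\<close>
    have "v i = 0" if "int_comb (Suc n) f v = \<one>" "i < Suc n" for v i
    proof (rule ccontr)
      assume "v i \<noteq> 0"
      have "f \<in> T" using f by (simp add: T_def)
      define s where "s = sgn (v i)"
      have "int_comb (Suc n) f (\<lambda>i. s * v i) = \<one>"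
        using that f by (simp add: int_comb_scale)
      from move[OF \<open>f \<in> T\<close> this that(2)] obtain e' v'
        where "e' \<in> T" "int_comb (Suc n) e' v' = \<one>" "v' n = \<bar>v i\<bar>"
        by (auto simp: s_def abs_sgn mult.commute)
      then have "nat \<bar>v i\<bar> \<in> K" using \<open>v i \<noteq> 0\<close> unfolding K_def by auto
      then show False using True by simp
    qed
    then have "f i [^] v i = \<one>" if "int_comb (Suc n) f v = \<one>" "i < Suc n" for v i
      using that by (metis int_pow_0)
    then have "independent (Suc n) f" unfolding independent_def by blast
    then show ?thesis using f by blast
  next
    case False
    define k where "k = (LEAST k. k \<in> K)"
    have "\<exists>k. k \<in> K" using False by blast
    then have "k \<in> K" unfolding k_def by (rule LeastI_ex)
    then obtain e v where k: "0 < k" and eT: "e \<in> T" and ev: "int_comb (Suc n) e v = \<one>"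
      and vn: "v n = int k" by (auto simp: K_def)
    have least: "r = 0" if "0 \<le> r" "r < int k" "g \<in> T" "int_comb (Suc n) g u = \<one>" "u n = r" for r g u
    proof (rule ccontr)
      assume "r \<noteq> 0"
      then have "nat r \<in> K" using that by (auto simp: K_def)
      then have "k \<le> nat r" unfolding k_def by (rule Least_le)
      then show False using that by linarith
    qed
    have e: "range e \<subseteq> carrier G" using eT by (simp add: T_def)
    have eG: "e i \<in> carrier G" for i using e by auto
    have T_upd: "g(n := g n \<otimes> a) \<in> T" if "g \<in> T" "a \<in> int_span n g" for g a
    proof -
      have g: "range g \<subseteq> carrier G" using that by (simp add: T_def)
      have "a \<in> carrier G" using that int_span_closed[OF g] by auto
      moreover have "g n \<in> carrier G" using g by auto
      ultimately show ?thesis using that g int_span_fun_upd_mult[OF g that(2)] by (auto simp: T_def)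
    qed
    \<comment> \<open>Division with remainder: moving \<open>e l [^] q\<close> into the last
      generator keeps its coefficient \<open>k\<close> and leaves the remainder \<open>r\<close> at
      \<open>l\<close>. Transposed to the end, \<open>r\<close> must vanish by minimality of
      \<open>k\<close>.\<close>
    have dvd: "int k dvd v l" if l: "l < n" for l
    proof -
      define q where "q = v l div int k"
      define r where "r = v l mod int k"
      let ?e = "e(n := e n \<otimes> e l [^] q)"
      have elq: "e l [^] q \<in> int_span n e"
        by (metis int_comb_in_span int_comb_single[OF e l])
      have e': "?e \<in> T" using T_upd[OF eT elq] .
      have "int_comb (Suc n) ?e (v(l := r)) = int_comb n e (v(l := r)) \<otimes> (e n \<otimes> e l [^] q) [^] int k"
      proof -
        have "range ?e \<subseteq> carrier G" using e' by (simp add: T_def)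
        moreover have "int_comb n ?e (v(l := r)) = int_comb n e (v(l := r))"
          by (rule int_comb_cong) (use e in auto)
        ultimately show ?thesis using l vn by (simp add: int_comb_Suc)
      qed
      also have "\<dots> = int_comb n e (v(l := r)) \<otimes> e l [^] (q * int k) \<otimes> e n [^] int k"
        using e eG by (simp add: int_pow_distrib int_pow_pow m_ac)
      also have "int_comb n e (v(l := r)) \<otimes> e l [^] (q * int k) = int_comb n e v"
      proof -
        have "int_comb n e (\<lambda>i. (v(l := r)) i + ((\<lambda>_. 0)(l := q * int k)) i) = int_comb n e v"
          by (rule int_comb_cong) (use e in \<open>auto simp: q_def r_def\<close>)
        then show ?thesis by (simp only: int_comb_add[OF e] int_comb_single[OF e l])
      qed
      also have "int_comb n e v \<otimes> e n [^] int k = \<one>"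
        using ev e vn by (simp add: int_comb_Suc)
      finally have "int_comb (Suc n) ?e (v(l := r)) = \<one>" .
      from move[OF e' this, of l] l obtain g u where "g \<in> T" "int_comb (Suc n) g u = \<one>" "u n = r"
        by auto
      then have "r = 0" using k by (intro least[of r g u]) (auto simp: r_def)
      then show ?thesis by (auto simp: r_def)
    qed
    \<comment> \<open>As \<open>k\<close> divides every coefficient, the relation says that the
      \<open>k\<close>-th power of \<open>e n \<otimes> b\<close> is trivial.\<close>
    define b where "b = int_comb n e (\<lambda>i. v i div int k)"
    define g where "g = e(n := e n \<otimes> b)"
    have gT: "g \<in> T" unfolding g_def by (rule T_upd[OF eT]) (simp add: b_def)
    then have g: "range g \<subseteq> carrier G" by (simp add: T_def)
    then have gG: "g i \<in> carrier G" for i by auto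
    have gnk: "g n [^] int k = \<one>"
    proof -
      have "b [^] int k = int_comb n e (\<lambda>i. int k * (v i div int k))"
        unfolding b_def by (rule int_comb_scale[OF e, symmetric])
      also have "\<dots> = int_comb n e v"
        by (rule int_comb_cong) (use e dvd in auto)
      finally have "b [^] int k = int_comb n e v" .
      moreover have "b \<in> carrier G" using e by (simp add: b_def)
      ultimately show ?thesis
        using eG ev e vn by (simp add: g_def int_pow_distrib int_comb_Suc m_comm)
    qed
    \<comment> \<open>A nonzero remainder modulo \<open>k\<close> would be a smaller positive
      coefficient, so \<open>g n\<close> contributes trivially to every relation. Its cyclic group
      splits off, and the induction hypothesis treats the other generators.\<close>
    have last: "g n [^] u n = \<one>" if "int_comb (Suc n) g u = \<one>" for u
    proof -
      define r where "r = u n mod int k"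
      have gu: "g n [^] u n = g n [^] r"
      proof -
        have "g n [^] u n = g n [^] (int k * (u n div int k) + r)" by (simp add: r_def)
        also have "\<dots> = g n [^] r"
          using gG gnk by (simp add: int_pow_mult int_pow_pow[symmetric])
        finally show ?thesis .
      qed
      have "int_comb n g (u(n := r)) = int_comb n g u" by (rule int_comb_cong) (use g in auto)
      then have "int_comb (Suc n) g (u(n := r)) = \<one>"
        using that g gu by (simp add: int_comb_Suc)
      then have "r = 0" using k gT by (intro least[of r g "u(n := r)"]) (auto simp: r_def)
      then show ?thesis using gu by simp
    qed
    obtain h where h: "range h \<subseteq> carrier G" "int_span n h = int_span n g" "independent n h"
      using Suc.IH[OF g] by blast
    define w where "w = h(n := g n)"
    have w: "range w \<subseteq> carrier G" using h(1) gG by (auto simp: w_def)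
    have comb_w: "int_comb n w u = int_comb n h u" for u
      by (rule int_comb_cong) (use h in \<open>auto simp: w_def\<close>)
    have "int_span n w = int_span n g" using h(2) by (simp add: int_span_def comb_w)
    then have "int_span (Suc n) w = int_span (Suc n) g"
      using w g by (intro int_span_Suc_cong) (auto simp: w_def)
    then have span: "int_span (Suc n) w = int_span (Suc n) f" using gT by (simp add: T_def)
    have "independent (Suc n) w"
      unfolding independent_def
    proof (intro allI impI)
      fix u i assume u: "int_comb (Suc n) w u = \<one>" and i: "i < Suc n"
      \<comment> \<open>The first \<open>n\<close> entries of \<open>h\<close> and \<open>g\<close>
        have the same span, so a relation of \<open>w\<close> turns into one of \<open>g\<close>, to
        which \<open>last\<close> applies.\<close>
      have "int_comb n h u \<in> int_span n g" using h(2) by (auto simp: int_span_def)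
      then obtain u' where u': "int_comb n h u = int_comb n g u'" by (auto simp: int_span_def)
      have "int_comb n g (u'(n := u n)) = int_comb n g u'" by (rule int_comb_cong) (use g in auto)
      then have "int_comb (Suc n) g (u'(n := u n)) = \<one>"
        using u w g u' by (simp add: int_comb_Suc comb_w) (simp add: w_def)
      then have gn: "g n [^] u n = \<one>" using last by fastforce
      then have "int_comb n h u = \<one>"
        using u w h(1) by (simp add: int_comb_Suc comb_w) (simp add: w_def)
      then show "w i [^] u i = \<one>"
        using h(3) i gn by (cases "i = n") (auto simp: w_def independent_def)
    qed
    then show ?thesis using w span by blast
  qed
qed

end

section \<open>Automata from chains of subgroups\<close>

context comm_group
begin

text \<open>
  \<open>E\<close> and \<open>E'\<close> are the elements represented by the states at two consecutive times, \<open>N\<close> and \<open>N'\<close>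
  the groups of elements acting on the corresponding subtrees. An element of \<open>N'\<close> fixes the
  first letter and is its own section at both letters; an element \<open>g\<close> of \<open>N - N'\<close> swaps the letters and
  has the sections \<open>g \<otimes> d\<close> and \<open>g \<otimes> inv d\<close>.
\<close>

definition halving_step :: "'a set \<Rightarrow> 'a set \<Rightarrow> 'a set \<Rightarrow> 'a set \<Rightarrow> bool" where
  "halving_step E N E' N' \<longleftrightarrow> N' \<subseteq> N \<and> (\<forall>g\<in>N - N'. \<forall>h\<in>N - N'. g \<otimes> h \<in> N') \<and> E \<inter> N' \<subseteq> E' \<and>
     (\<exists>d\<in>N. (N \<noteq> N' \<longrightarrow> d \<notin> N') \<and> (\<forall>e\<in>E - N'. e \<otimes> d \<in> E' \<and> e \<otimes> inv d \<in> E'))"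

text \<open>The \<open>n\<close> states of the automaton are to enumerate \<open>E\<close>, possibly
  with repetitions; for this \<open>E\<close> must be nonempty with at most \<open>n\<close>
  elements.\<close>

definition chain_state :: "nat \<Rightarrow> 'a set \<Rightarrow> 'a set \<Rightarrow> bool" where
  "chain_state n E N \<longleftrightarrow> E \<noteq> {} \<and> finite E \<and> card E \<le> n \<and> E \<subseteq> N \<and> subgroup N G"

definition halving_chain :: "nat \<Rightarrow> (nat \<Rightarrow> 'a set) \<Rightarrow> (nat \<Rightarrow> 'a set) \<Rightarrow> bool" where
  "halving_chain n E N \<longleftrightarrow> (\<forall>i. chain_state n (E i) (N i) \<and> halving_step (E i) (N i) (E (Suc i)) (N (Suc i)))
     \<and> (\<Inter>i. N i) = {\<one>}"

definition starts_chain :: "nat \<Rightarrow> 'a set \<Rightarrow> 'a set \<Rightarrow> bool" where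
  "starts_chain n E N \<longleftrightarrow> (\<exists>S M. S 0 = E \<and> M 0 = N \<and> halving_chain n S M)"

text \<open>If the group does not shrink, all its elements are their own sections and the shift
  \<open>\<one>\<close> works. Such idle steps lengthen a chain or enlarge the set of
  states.\<close>

lemma halving_step_refl: "subgroup N G \<Longrightarrow> E \<subseteq> E' \<Longrightarrow> E \<subseteq> N \<Longrightarrow> halving_step E N E' N"
  unfolding halving_step_def by (auto intro!: bexI[of _ \<one>] simp: subgroup.one_closed)

text \<open>Chains grow at the front; the intersection stays the same because \<open>N'\<close> is
  contained in \<open>N\<close>.\<close>

lemma starts_chain_Cons:
  assumes "chain_state n E N" "halving_step E N E' N'" "starts_chain n E' N'"
  shows "starts_chain n E N"
proof -
  obtain S M where SM: "S 0 = E'" "M 0 = N'" "halving_chain n S M"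
    using assms(3) by (auto simp: starts_chain_def)
  have sub: "N' \<subseteq> N" using assms(2) by (simp add: halving_step_def)
  have "(\<Inter>i. case_nat N M i) = N \<inter> (\<Inter>i. M i)"
  proof -
    have "(\<forall>i. x \<in> case_nat N M i) \<longleftrightarrow> x \<in> N \<and> (\<forall>i. x \<in> M i)" for x
      by (metis nat.case(1,2) not0_implies_Suc)
    then show ?thesis by auto
  qed
  then have "(\<Inter>i. case_nat N M i) = (\<Inter>i. M i)"
    using sub SM(2) by blast
  moreover have "chain_state n (case_nat E S i) (case_nat N M i) \<and>
      halving_step (case_nat E S i) (case_nat N M i) (case_nat E S (Suc i)) (case_nat N M (Suc i))" for i
    using SM assms(1,2) by (cases i) (auto simp: halving_chain_def)
  ultimately have "halving_chain n (case_nat E S) (case_nat N M)"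
    using SM(3) by (auto simp: halving_chain_def)
  then show ?thesis unfolding starts_chain_def by (intro exI conjI) auto
qed

end

locale chain_automaton = comm_group G for G :: "'a monoid" (structure) +
  fixes n :: nat and E N :: "nat \<Rightarrow> 'a set"
  assumes chain: "halving_chain n E N"
begin

section \<open>The action of the group on words along a chain\<close>

definition shift :: "nat \<Rightarrow> 'a" where
  "shift i = (SOME d. d \<in> N i \<and> (N i \<noteq> N (Suc i) \<longrightarrow> d \<notin> N (Suc i)) \<and>
     (\<forall>e\<in>E i - N (Suc i). e \<otimes> d \<in> E (Suc i) \<and> e \<otimes> inv d \<in> E (Suc i)))"

definition child :: "nat \<Rightarrow> 'a \<Rightarrow> nat \<Rightarrow> 'a" where
  "child i g x = (if g \<in> N (Suc i) then g else if x = 0 then g \<otimes> shift i else g \<otimes> inv (shift i))"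

definition flip :: "nat \<Rightarrow> 'a \<Rightarrow> nat \<Rightarrow> nat" where
  "flip i g x = (if g \<in> N (Suc i) then x else 1 - x)"

fun act :: "nat \<Rightarrow> 'a \<Rightarrow> nat list \<Rightarrow> nat list" where
  "act i g [] = []"
| "act i g (x # w) = flip i g x # act (Suc i) (child i g x) w"

lemma N: "subgroup (N i) G" and step: "halving_step (E i) (N i) (E (Suc i)) (N (Suc i))"
  and E: "E i \<noteq> {}" "finite (E i)" "card (E i) \<le> n" "E i \<subseteq> N i"
  using chain by (auto simp: halving_chain_def chain_state_def)

lemma N_carrier: "g \<in> N i \<Longrightarrow> g \<in> carrier G"
  using subgroup.mem_carrier[OF N] .

lemma N_Suc: "g \<in> N (Suc i) \<Longrightarrow> g \<in> N i"
  using step[of i] by (auto simp: halving_step_def)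

lemma N_mult: "g \<in> N i \<Longrightarrow> h \<in> N i \<Longrightarrow> g \<otimes> h \<in> N i"
  using subgroup.m_closed[OF N] .

lemma N_inv: "g \<in> N i \<Longrightarrow> inv g \<in> N i"
  using subgroup.m_inv_closed[OF N] .

lemma N_inv_iff: "g \<in> carrier G \<Longrightarrow> inv g \<in> N i \<longleftrightarrow> g \<in> N i"
  using N_inv[of g i] N_inv[of "inv g" i] by auto

text \<open>The index of \<open>N (Suc i)\<close> in \<open>N i\<close> is at most 2, so membership
  behaves like a parity.\<close>

lemma N_mult_iff:
  assumes "g \<in> N i" "h \<in> N i"
  shows "g \<otimes> h \<in> N (Suc i) \<longleftrightarrow> (g \<in> N (Suc i) \<longleftrightarrow> h \<in> N (Suc i))"
proof -
  have g: "g \<in> carrier G" and h: "h \<in> carrier G" using assms N_carrier by auto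
  have "g = (g \<otimes> h) \<otimes> inv h" "h = inv g \<otimes> (g \<otimes> h)"
    using g h by (simp_all add: m_assoc[symmetric]) (simp add: m_assoc)
  moreover have "g \<notin> N (Suc i) \<Longrightarrow> h \<notin> N (Suc i) \<Longrightarrow> g \<otimes> h \<in> N (Suc i)"
    using step[of i] assms by (auto simp: halving_step_def)
  ultimately show ?thesis by (metis N_mult N_inv)
qed

lemma shift:
  "shift i \<in> N i" "N i \<noteq> N (Suc i) \<Longrightarrow> shift i \<notin> N (Suc i)"
  "e \<in> E i \<Longrightarrow> e \<notin> N (Suc i) \<Longrightarrow> e \<otimes> shift i \<in> E (Suc i)"
  "e \<in> E i \<Longrightarrow> e \<notin> N (Suc i) \<Longrightarrow> e \<otimes> inv (shift i) \<in> E (Suc i)"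
proof -
  have "\<exists>d. d \<in> N i \<and> (N i \<noteq> N (Suc i) \<longrightarrow> d \<notin> N (Suc i)) \<and>
     (\<forall>e\<in>E i - N (Suc i). e \<otimes> d \<in> E (Suc i) \<and> e \<otimes> inv d \<in> E (Suc i))"
    using step[of i] unfolding halving_step_def by blast
  from someI_ex[OF this] show
    "shift i \<in> N i" "N i \<noteq> N (Suc i) \<Longrightarrow> shift i \<notin> N (Suc i)"
    "e \<in> E i \<Longrightarrow> e \<notin> N (Suc i) \<Longrightarrow> e \<otimes> shift i \<in> E (Suc i)"
    "e \<in> E i \<Longrightarrow> e \<notin> N (Suc i) \<Longrightarrow> e \<otimes> inv (shift i) \<in> E (Suc i)"
    unfolding shift_def by blast+
qed

lemma child_N:
  assumes "g \<in> N i"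
  shows "child i g x \<in> N (Suc i)"
proof (cases "g \<in> N (Suc i)")
  case False
  then have "shift i \<notin> N (Suc i)" using shift(2)[of i] assms by auto
  then show ?thesis
    using False N_mult_iff assms shift(1)[of i] N_inv[OF shift(1)] N_inv_iff[of "shift i"]
      N_carrier[OF shift(1)]
    by (auto simp: child_def)
qed (simp add: child_def)

lemma child_E: "e \<in> E i \<Longrightarrow> child i e x \<in> E (Suc i)"
  using step[of i] shift(3,4) by (auto simp: child_def halving_step_def)

lemma flip_closed: "x \<in> {0, 1} \<Longrightarrow> flip i g x \<in> {0, 1}"
  by (auto simp: flip_def)

lemma flip_mult:
  assumes "g \<in> N i" "h \<in> N i" "x \<in> {0, 1}"
  shows "flip i (g \<otimes> h) x = flip i g (flip i h x)"
  using assms by (auto simp: flip_def N_mult_iff)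

text \<open>The rule for sections of a composition. If both factors swap, they act on different
  letters, and the shift cancels with its inverse; if one swaps, the same shift remains on both
  sides.\<close>

lemma child_mult:
  assumes "g \<in> N i" "h \<in> N i" "x \<in> {0, 1}"
  shows "child i (g \<otimes> h) x = child i g (flip i h x) \<otimes> child i h x"
proof -
  have [simp]: "g \<in> carrier G" "h \<in> carrier G" "shift i \<in> carrier G"
    using assms N_carrier shift(1) by auto
  have *: "(g \<otimes> inv (shift i)) \<otimes> (h \<otimes> shift i) = g \<otimes> h"
    "(g \<otimes> shift i) \<otimes> (h \<otimes> inv (shift i)) = g \<otimes> h"
  proof -
    have "(g \<otimes> inv (shift i)) \<otimes> (h \<otimes> shift i) = (g \<otimes> h) \<otimes> (inv (shift i) \<otimes> shift i)"
      by (simp only: m_ac m_closed inv_closed \<open>g \<in> carrier G\<close> \<open>h \<in> carrier G\<close> \<open>shift i \<in> carrier G\<close>)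
    then show "(g \<otimes> inv (shift i)) \<otimes> (h \<otimes> shift i) = g \<otimes> h" by simp
    have "(g \<otimes> shift i) \<otimes> (h \<otimes> inv (shift i)) = (g \<otimes> h) \<otimes> (shift i \<otimes> inv (shift i))"
      by (simp only: m_ac m_closed inv_closed \<open>g \<in> carrier G\<close> \<open>h \<in> carrier G\<close> \<open>shift i \<in> carrier G\<close>)
    then show "(g \<otimes> shift i) \<otimes> (h \<otimes> inv (shift i)) = g \<otimes> h" by simp
  qed
  show ?thesis
    using assms(3) by (auto simp: child_def flip_def N_mult_iff[OF assms(1,2)] *) (simp_all add: m_ac)
qed

lemma act_closed: "w \<in> lists {0, 1} \<Longrightarrow> act i g w \<in> lists {0, 1}"
proof (induction w arbitrary: i g)
  case (Cons x w)
  then show ?case using flip_closed[of x i g] by simp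
qed simp

lemma act_mult:
  assumes "g \<in> N i" "h \<in> N i" "w \<in> lists {0, 1}"
  shows "act i (g \<otimes> h) w = act i g (act i h w)"
  using assms
proof (induction w arbitrary: i g h)
  case (Cons x w)
  then have x: "x \<in> {0, 1}" by simp
  show ?case
    using Cons.IH[OF child_N[OF Cons.prems(1)] child_N[OF Cons.prems(2)]] Cons.prems(3)
    by (simp add: flip_mult[OF Cons.prems(1,2) x] child_mult[OF Cons.prems(1,2) x])
qed simp

lemma act_one: "act i \<one> w = w"
  by (induction w arbitrary: i) (auto simp: child_def flip_def subgroup.one_closed[OF N])

text \<open>Fixing the letter 0 at time \<open>j\<close> forces \<open>g\<close> into
  \<open>N (Suc j)\<close>, where it is its own section and again fixes all words. So
  \<open>g\<close> lies in all later groups, and in the earlier ones because the chain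
  decreases.\<close>

lemma act_faithful:
  assumes "g \<in> N i" "\<And>w. w \<in> lists {0, 1} \<Longrightarrow> act i g w = w"
  shows "g = \<one>"
proof -
  have fix_Suc: "g \<in> N (Suc j) \<and> (\<forall>w\<in>lists {0, 1}. act (Suc j) g w = w)"
    if "\<forall>w\<in>lists {0, 1}. act j g w = w" for j
  proof -
    have "[0] \<in> lists {0, 1 :: nat}" by simp
    then have "act j g [0] = [0]" using that by blast
    then have *: "g \<in> N (Suc j)" by (auto simp: flip_def split: if_splits)
    moreover have "act (Suc j) g w = w" if "w \<in> lists {0, 1}" for w
      using \<open>\<forall>w\<in>lists {0, 1}. act j g w = w\<close>[rule_format, of "0 # w"] that * by (simp add: child_def)
    ultimately show ?thesis by blast
  qed
  have up: "g \<in> N j \<and> (\<forall>w\<in>lists {0, 1}. act j g w = w)" if "i \<le> j" for j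
    using that by (induction j rule: dec_induct) (use assms fix_Suc in auto)
  have "g \<in> N j" for j
  proof (cases "i \<le> j")
    case False
    then have "j \<le> i" by simp
    then show ?thesis
      by (induction j rule: inc_induct) (use assms(1) N_Suc in auto)
  qed (use up in auto)
  then show ?thesis using chain by (auto simp: halving_chain_def)
qed

lemma act_bij: 
  assumes "g \<in> N i"
  shows "bij_betw (act i g) (lists {0, 1}) (lists {0, 1})"
proof (rule bij_betw_byWitness[where f' = "act i (inv g)"])
  have g: "g \<in> carrier G" using assms N_carrier by auto
  show "\<forall>w\<in>lists {0, 1}. act i (inv g) (act i g w) = w"
    using act_mult[OF N_inv[OF assms] assms] g by (simp add: act_one)
  show "\<forall>w\<in>lists {0, 1}. act i g (act i (inv g) w) = w"
    using act_mult[OF assms N_inv[OF assms]] g by (simp add: act_one)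
qed (use act_closed in blast)+

text \<open>Elements are repeated when \<open>E i\<close> is small, since the automaton must have
  exactly \<open>n\<close> states.\<close>

definition label :: "nat \<Rightarrow> nat \<Rightarrow> 'a" where
  "label i = (SOME f. f ` {..<n} = E i)"

lemma label: "label i ` {..<n} = E i"
proof -
  have "\<exists>f. f ` {..<n} = E i"
  proof -
    obtain f where "bij_betw f {..<card (E i)} (E i)"
      using ex_bij_betw_nat_finite[OF E(2)] by (auto simp: atLeast0LessThan)
    then have f: "f ` {..<card (E i)} = E i" by (simp add: bij_betw_def)
    obtain a where a: "a \<in> E i" using E(1) by blast
    let ?f = "\<lambda>k. if k < card (E i) then f k else a"
    have "?f ` {..<n} \<subseteq> E i" using f a by auto
    moreover have "E i \<subseteq> ?f ` {..<n}"
    proof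
      fix x assume "x \<in> E i"
      then obtain k where "k < card (E i)" "x = f k" using f by blast
      then show "x \<in> ?f ` {..<n}" using E(3)[of i] by (intro image_eqI[of _ _ k]) auto
    qed
    ultimately have "?f ` {..<n} = E i" by blast
    then show ?thesis by blast
  qed
  then show ?thesis unfolding label_def by (rule someI_ex)
qed

text \<open>Time in an automaton starts at 1, hence the index shift.\<close>

definition aut :: "(nat, nat) tv_automaton" where
  "aut = \<lparr>alphabet = {0, 1}, states = {..<n},
     trans = \<lambda>i q x. inv_into {..<n} (label i) (child (i - 1) (label (i - 1) q) x),
     outp = \<lambda>i q. flip (i - 1) (label (i - 1) q)\<rparr>"

lemma inv_label:
  assumes "e \<in> E i"
  shows "inv_into {..<n} (label i) e < n" "label i (inv_into {..<n} (label i) e) = e"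
  using assms inv_into_into[of e "label i" "{..<n}"] f_inv_into_f[of e "label i" "{..<n}"] label
  by auto

lemma label_E: "q < n \<Longrightarrow> label i q \<in> E i"
  using label by blast

lemma invertible_aut: "invertible_tv_automaton aut"
proof
  show "trans aut i q x \<in> states aut" if "1 \<le> i" "q \<in> states aut" for i q x
    using that inv_label(1)[OF child_E[OF label_E], of q "i - 1" x] by (simp add: aut_def)
  show "outp aut i q x \<in> alphabet aut" if "x \<in> alphabet aut" for i q x
    using that flip_closed[of x] by (simp add: aut_def)
  show "bij_betw (outp aut i q) (alphabet aut) (alphabet aut)" for i q
    by (rule bij_betw_byWitness[where f' = "outp aut i q"]) (auto simp: aut_def flip_def)
qed (auto simp: aut_def)

lemma state_action_aut:
  "q < n \<Longrightarrow> state_action aut (Suc i) q w = act i (label i q) w"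
proof (induction w arbitrary: i q)
  case (Cons x w)
  have "child i (label i q) x \<in> E (Suc i)" using child_E[OF label_E[OF Cons.prems]] .
  from inv_label[OF this] show ?case
    using Cons.IH[of "inv_into {..<n} (label (Suc i)) (child i (label i q) x)" "Suc i"] Cons.prems
    by (simp add: aut_def)
qed simp

text \<open>\<open>act 0\<close> embeds \<open>G\<close> into the bijections of words, and the
  states at time 1 act as the elements of \<open>E 0\<close>. As these generate \<open>G\<close>,
  their images generate the image of \<open>G\<close>.\<close>

lemma generated_by_halving_chain:
  assumes N0: "N 0 = carrier G" and gen: "generate G (E 0) = carrier G"
  shows "generated_by_tv_automaton n {0, 1 :: nat} G"
proof -
  interpret aut: invertible_tv_automaton aut by (rule invertible_aut)
  let ?L = "lists {0, 1 :: nat}"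
  define \<Phi> where "\<Phi> g = restrict (act 0 g) ?L" for g
  have Bij: "\<Phi> g \<in> Bij ?L" if "g \<in> carrier G" for g
    using act_bij[of g 0] that N0 by (auto simp: \<Phi>_def Bij_def simp del: One_nat_def cong: bij_betw_cong)
  have hom: "\<Phi> \<in> hom G (BijGroup ?L)"
  proof (rule homI)
    fix g h assume gh: "g \<in> carrier G" "h \<in> carrier G"
    have "compose ?L (\<Phi> g) (\<Phi> h) w = \<Phi> (g \<otimes> h) w" for w
      using act_mult[of g 0 h w] act_closed[of w 0 h] gh N0
      by (auto simp: compose_def \<Phi>_def restrict_def)
    then show "\<Phi> (g \<otimes> h) = \<Phi> g \<otimes>\<^bsub>BijGroup ?L\<^esub> \<Phi> h"
      using Bij gh by (simp add: BijGroup_def fun_eq_iff)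
  qed (use Bij in \<open>simp add: BijGroup_def\<close>)
  interpret group_hom G "BijGroup ?L" \<Phi>
    using hom group_BijGroup by (intro group_hom.intro group_hom_axioms.intro) auto
  have inj: "inj_on \<Phi> (carrier G)"
  proof -
    have "g = \<one>" if "g \<in> carrier G" and \<Phi>: "\<Phi> g = \<one>\<^bsub>BijGroup ?L\<^esub>" for g
    proof (rule act_faithful[of g 0])
      show "act 0 g w = w" if "w \<in> ?L" for w
      proof -
        have "\<Phi> g = (\<lambda>w\<in>?L. w)" using \<Phi> by (simp only: BijGroup_def monoid.simps)
        then show ?thesis using that unfolding \<Phi>_def by (metis restrict_apply')
      qed
    qed (use that N0 in simp)
    then show ?thesis using inj_on_one_iff by blast
  qed
  have states: "state_aut aut 1 ` states aut = \<Phi> ` E 0"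
  proof -
    have "state_aut aut 1 q = \<Phi> (label 0 q)" if "q < n" for q
    proof -
      have "alphabet aut = {0, 1}" by (simp add: aut_def)
      then show ?thesis
        using state_action_aut[OF that, of 0] by (simp add: state_aut_def \<Phi>_def restrict_def fun_eq_iff)
    qed
    then have "state_aut aut 1 ` states aut = \<Phi> ` label 0 ` {..<n}"
      by (force simp: aut_def image_iff)
    then show ?thesis by (simp only: label)
  qed
  have sub: "\<Phi> ` E 0 \<subseteq> tree_automorphisms {0, 1}"
  proof -
    have "state_aut aut 1 ` states aut \<subseteq> tree_automorphisms (alphabet aut)"
      by (intro image_subsetI aut.state_aut_in_tree_automorphisms) auto
    then show ?thesis unfolding states by (simp add: aut_def)
  qed
  \<comment> \<open>The state automorphisms lie in the subgroup of tree automorphisms, so they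
    generate the same set there as among all bijections of words.\<close>
  have "carrier (automaton_group aut) = generate (BijGroup ?L) (\<Phi> ` E 0)"
    unfolding automaton_group_def states tree_aut_group_def
    using sub group.generate_consistent[OF group_BijGroup _ subgroup_tree_automorphisms, of "\<Phi> ` E 0" "{0, 1}"]
    by (simp add: aut_def)
  also have "\<dots> = \<Phi> ` carrier G"
    using generate_img[of "E 0"] E(4)[of 0] N0 gen by simp
  finally have "bij_betw \<Phi> (carrier G) (carrier (automaton_group aut))"
    using inj by (simp add: bij_betw_def)
  moreover have "\<Phi> \<in> hom G (automaton_group aut)"
    using hom bij_betw_imp_funcset[OF calculation]
    by (auto simp: hom_def automaton_group_def tree_aut_group_def aut_def)
  ultimately have "G \<cong> automaton_group aut" by (auto simp: is_iso_def iso_def)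
  then show ?thesis
    using invertible_aut unfolding generated_by_tv_automaton_def
    by (intro exI[of _ aut]) (simp add: aut_def)
qed

end

section \<open>Existence of chains\<close>

context comm_group
begin

text \<open>The 2-group condition on the torsion part, put into integer exponents to match
  \<open>int_comb\<close>.\<close>

definition torsion_two_primary :: bool where
  "torsion_two_primary \<longleftrightarrow>
     (\<forall>g\<in>carrier G. \<forall>m::int. m \<noteq> 0 \<longrightarrow> g [^] m = \<one> \<longrightarrow> (\<exists>k::nat. g [^] (2 ^ k :: int) = \<one>))"

text \<open>Since \<open>2 ^ k\<close> and \<open>m\<close> are coprime, Bezout writes
  \<open>g\<close> as a product of powers of two trivial elements.\<close>

lemma no_odd_torsion:
  assumes "torsion_two_primary" "g \<in> carrier G" "g [^] (m::int) = \<one>" "odd m"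
  shows "g = \<one>"
proof -
  have "m \<noteq> 0" using assms(4) by auto
  then obtain k where k: "g [^] (2 ^ k :: int) = \<one>"
    using assms unfolding torsion_two_primary_def by blast
  have "coprime (2 ^ k) m" using assms(4) by simp
  then obtain u v where uv: "u * 2 ^ k + v * m = 1"
    using bezout_int[of "2 ^ k" m] by (auto simp: coprime_iff_gcd_eq_1)
  have "g = g [^] (2 ^ k * u + m * v)" using assms(2) uv by (simp add: mult.commute)
  also have "\<dots> = \<one>"
    using assms(2,3) k by (simp add: int_pow_mult int_pow_pow[symmetric])
  finally show ?thesis .
qed

section \<open>Halving one coordinate of an independent tuple\<close>

lemma independentD:
  "independent n e \<Longrightarrow> int_comb n e v = \<one> \<Longrightarrow> i < n \<Longrightarrow> e i [^] v i = \<one>"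
  by (simp add: independent_def)

text \<open>The substitution doubles the \<open>j\<close>-th coordinate; conversely an even
  coordinate can be halved and the others corrected by multiples of \<open>b\<close>. This span is
  the next group of the chain.\<close>

lemma int_span_halve:
  assumes e: "range e \<subseteq> carrier G" and j: "j < n" and b: "b j = 2"
  shows "int_span n (e(j := int_comb n e b)) = int_comb n e ` {u. even (u j)}"
proof (intro equalityI subsetI)
  fix x assume "x \<in> int_span n (e(j := int_comb n e b))"
  then obtain v where "x = int_comb n e (\<lambda>i. (v(j := 0)) i + v j * b i)"
    by (auto simp: int_span_def int_comb_fun_upd_comb[OF e j])
  then show "x \<in> int_comb n e ` {u. even (u j)}" using b by auto
next
  fix x assume "x \<in> int_comb n e ` {u. even (u j)}"
  then obtain u where u: "x = int_comb n e u" "even (u j)" by blast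
  define v where "v = (\<lambda>i. u i - u j div 2 * b i)(j := u j div 2)"
  have "int_comb n (e(j := int_comb n e b)) v = int_comb n e (\<lambda>i. (v(j := 0)) i + v j * b i)"
    by (rule int_comb_fun_upd_comb[OF e j])
  also have "\<dots> = x"
    unfolding u(1) by (rule int_comb_cong) (use e b u(2) in \<open>auto simp: v_def\<close>)
  finally show "x \<in> int_span n (e(j := int_comb n e b))" by (auto simp: int_span_def)
qed

text \<open>Coordinates need not be unique, but the parity at \<open>j\<close> is: two
  representations differ by a relation, and an odd coefficient in it would make \<open>e j\<close>
  trivial, as there is no odd torsion.\<close>

lemma in_int_span_halve_iff:
  assumes "torsion_two_primary" and e: "range e \<subseteq> carrier G" "independent n e"
    and j: "j < n" "e j \<noteq> \<one>" and b: "b j = 2"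
  shows "int_comb n e u \<in> int_span n (e(j := int_comb n e b)) \<longleftrightarrow> even (u j)"
proof
  assume "int_comb n e u \<in> int_span n (e(j := int_comb n e b))"
  then obtain v where v: "even (v j)" "int_comb n e u = int_comb n e v"
    unfolding int_span_halve[where b = b, OF e(1) j(1) b] by auto
  have "int_comb n e (\<lambda>i. u i + - v i) = \<one>"
    using e(1) v by (simp only: int_comb_add int_comb_neg) simp
  then have "e j [^] (u j + - v j) = \<one>" using independentD[OF e(2)] j by blast
  moreover have "e j \<in> carrier G" using e by auto
  ultimately have "even (u j + - v j)" using no_odd_torsion[OF assms(1)] j(2) by blast
  then show "even (u j)" using v by simp
qed (use int_span_halve[where b = b, OF e(1) j(1) b] in blast)

text \<open>The shift \<open>int_comb n e b \<otimes> inv (e j)\<close> has coordinate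
  \<open>2 - 1\<close> at \<open>j\<close>, hence lies outside the halved span; two elements with
  odd coordinate multiply into it.\<close>

lemma halving_step_halve:
  assumes "torsion_two_primary" and e: "range e \<subseteq> carrier G" "independent n e"
    and j: "j < n" "e j \<noteq> \<one>" and b: "b j = 2"
    and E: "E \<inter> int_span n (e(j := int_comb n e b)) \<subseteq> E'"
    and shift: "\<And>a. a \<in> E \<Longrightarrow> a \<notin> int_span n (e(j := int_comb n e b)) \<Longrightarrow>
      a \<otimes> (int_comb n e b \<otimes> inv (e j)) \<in> E' \<and> a \<otimes> inv (int_comb n e b \<otimes> inv (e j)) \<in> E'"
  shows "halving_step E (int_span n e) E' (int_span n (e(j := int_comb n e b)))"
proof -
  let ?N = "int_span n (e(j := int_comb n e b))"
  note iff = in_int_span_halve_iff[where b = b, OF assms(1) e j b]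
  have "int_comb n e b \<otimes> inv (e j) = int_comb n e (\<lambda>i. b i + - ((\<lambda>_. 0)(j := 1)) i)"
    by (simp only: int_comb_add[OF e(1)] int_comb_neg[OF e(1)] int_comb_unit[OF e(1) j(1)])
  then have d: "int_comb n e b \<otimes> inv (e j) \<in> int_span n e" "int_comb n e b \<otimes> inv (e j) \<notin> ?N"
    using b by (simp_all only: int_comb_in_span iff) simp
  have "?N \<subseteq> int_span n e"
    using int_span_halve[where b = b, OF e(1) j(1) b] by auto
  moreover have "g \<otimes> h \<in> ?N" if gh: "g \<in> int_span n e - ?N" "h \<in> int_span n e - ?N" for g h
  proof -
    obtain u v where "g = int_comb n e u" "h = int_comb n e v" using gh by (auto simp: int_span_def)
    then show ?thesis using gh iff by (simp add: int_comb_add[OF e(1), symmetric])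
  qed
  ultimately show ?thesis
    unfolding halving_step_def using d E shift by blast
qed

text \<open>A relation of the new tuple, rewritten in the old one, gives
  \<open>e j [^] (2 * v j) = \<one>\<close>. The assumption on orders then removes the contributions
  \<open>v j * b i\<close>, so that each factor is trivial by itself.\<close>

lemma independent_halve:
  assumes e: "range e \<subseteq> carrier G" "independent n e" and j: "j < n" and b: "b j = 2"
    and ord: "\<And>m i. e j [^] (2 * m) = \<one> \<Longrightarrow> i < n \<Longrightarrow> i \<noteq> j \<Longrightarrow> e i [^] (m * b i) = \<one>"
  shows "independent n (e(j := int_comb n e b))"
  unfolding independent_def
proof (intro allI impI)
  fix v i assume v: "int_comb n (e(j := int_comb n e b)) v = \<one>" and i: "i < n"
  have eG: "e i \<in> carrier G" for i using e by auto
  have rel: "e k [^] ((v(j := 0)) k + v j * b k) = \<one>" if "k < n" for k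
    using independentD[OF e(2) _ that] v by (simp only: int_comb_fun_upd_comb[OF e(1) j])
  have *: "e j [^] (2 * v j) = \<one>" using rel[OF j] b by (simp add: mult.commute)
  have b1: "e k [^] (v j * b k) = \<one>" if "k < n" for k
    using * ord[OF * that] b by (cases "k = j") (auto simp: mult.commute)
  show "(e(j := int_comb n e b)) i [^] v i = \<one>"
  proof (cases "i = j")
    case True
    have "int_comb n e b [^] v j = int_comb n e (\<lambda>i. v j * b i)"
      by (rule int_comb_scale[OF e(1), symmetric])
    also have "\<dots> = \<one>"
      unfolding int_comb_def using b1 by (intro finprod_one_eqI) auto
    finally show ?thesis using True by simp
  next
    case False
    then show ?thesis using rel[OF i] b1[OF i] eG by (simp add: int_pow_mult)
  qed
qed

text \<open>
  The step replaces \<open>e j\<close> by \<open>e j [^] 2 \<otimes> inv (e l)\<close> with \<open>l \<noteq> j\<close>; independence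
  survives if \<open>e l\<close> is trivial or if all generators have infinite order.
\<close>

definition splittable :: "nat \<Rightarrow> (nat \<Rightarrow> 'a) \<Rightarrow> bool" where
  "splittable n e \<longleftrightarrow> range e \<subseteq> carrier G \<and> independent n e \<and>
     ((\<exists>l<n. e l = \<one>) \<or> (\<forall>j<n. \<forall>m::int. e j [^] m = \<one> \<longrightarrow> m = 0))"

abbreviation tuple_step :: "nat \<Rightarrow> (nat \<Rightarrow> 'a) \<Rightarrow> (nat \<Rightarrow> 'a) \<Rightarrow> bool" where
  "tuple_step n e e' \<equiv> halving_step (e ` {..<n}) (int_span n e) (e' ` {..<n}) (int_span n e')"

text \<open>The clause on \<open>v\<close> serves to expel a given element: an even coordinate is
  halved without becoming trivial in its cyclic group, an odd one puts the element outside the next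
  group.\<close>

lemma splittable_step:
  assumes "torsion_two_primary" and e: "splittable n e" and n: "n \<ge> 2" and j: "j < n" "e j \<noteq> \<one>"
  shows "\<exists>e'. splittable n e' \<and> tuple_step n e e' \<and>
    (\<forall>v. if even (v j)
      then \<exists>v'. int_comb n e v = int_comb n e' v' \<and> v' j = v j div 2 \<and>
        (e j [^] v j \<noteq> \<one> \<longrightarrow> e' j [^] v' j \<noteq> \<one>)
      else int_comb n e v \<notin> int_span n e')"
proof -
  have eG: "range e \<subseteq> carrier G" and ind: "independent n e" using e by (auto simp: splittable_def)
  have eiG: "e i \<in> carrier G" for i using eG by auto
  \<comment> \<open>A trivial generator has an index other than \<open>j\<close> because
    \<open>e j\<close> is nontrivial. Without one, all orders are infinite and any other index will
    do.\<close>
  obtain l where l: "l < n" "l \<noteq> j" "e l = \<one> \<or> (\<forall>j<n. \<forall>m::int. e j [^] m = \<one> \<longrightarrow> m = 0)"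
  proof (cases "\<exists>l<n. e l = \<one>")
    case True
    then show ?thesis using that j by blast
  next
    case False
    moreover have "(if j = 0 then 1 else 0) < n" using n by simp
    ultimately show ?thesis using that[of "if j = 0 then 1 else 0"] e by (auto simp: splittable_def)
  qed
  define b :: "nat \<Rightarrow> int" where "b = (\<lambda>_. 0)(j := 2, l := - 1)"
  have b: "b j = 2" using l by (simp add: b_def)
  define x where "x = int_comb n e b"
  define e' where "e' = e(j := x)"
  have x: "x = e j [^] (2::int) \<otimes> inv (e l)"
  proof -
    have "b = (\<lambda>i. ((\<lambda>_. 0)(j := 2)) i + - ((\<lambda>_. 0)(l := 1)) i)"
      using l by (auto simp: b_def)
    then show ?thesis unfolding x_def
      by (simp only: int_comb_add[OF eG] int_comb_neg[OF eG] int_comb_unit[OF eG l(1)]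
          int_comb_single[OF eG j(1)])
  qed
  have xG: "x \<in> carrier G" using eG by (simp add: x_def)
  have ord: "e i [^] (m * b i) = \<one>" if m: "e j [^] (2 * m) = \<one>" "i \<noteq> j" for m :: int and i
  proof (cases "e l = \<one>")
    case True
    then show ?thesis using m(2) by (auto simp: b_def)
  next
    case False
    then have "2 * m = 0" using l(3) j(1) m(1) by blast
    then show ?thesis by simp
  qed
  have e': "range e' \<subseteq> carrier G" using eG xG by (auto simp: e'_def)
  have ind': "independent n e'"
    unfolding e'_def x_def using independent_halve[where b = b, OF eG ind j(1) b ord] by blast
  have x_pow: "e j [^] (2 * m) = \<one>" if "x [^] m = \<one>" for m :: int
  proof -
    have "int_comb n e (\<lambda>i. m * b i) = \<one>" using that by (simp add: int_comb_scale[OF eG] x_def)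
    from independentD[OF ind this j(1)] show ?thesis using b by (simp add: mult.commute)
  qed
  have "splittable n e'"
    unfolding splittable_def
  proof (intro conjI e' ind')
    show "(\<exists>l<n. e' l = \<one>) \<or> (\<forall>j<n. \<forall>m::int. e' j [^] m = \<one> \<longrightarrow> m = 0)"
    proof (cases "e l = \<one>")
      case True
      then have "e' l = \<one>" using l(2) by (simp add: e'_def)
      then show ?thesis using l(1) by blast
    next
      case False
      have "m = 0" if "k < n" "e' k [^] m = \<one>" for k and m :: int
      proof (cases "k = j")
        case True
        then have "e j [^] (2 * m) = \<one>" using that x_pow[of m] by (simp add: e'_def)
        then have "2 * m = 0" using False l(3) j(1) by blast
        then show ?thesis by simp
      qed (use False that l(3) in \<open>simp add: e'_def\<close>)
      then show ?thesis by blast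
    qed
  qed
  moreover have "tuple_step n e e'"
    unfolding e'_def x_def
  proof (rule halving_step_halve[where b = b, OF assms(1) eG ind j b])
    let ?N = "int_span n (e(j := int_comb n e b))"
    have ejN: "e j \<notin> ?N"
      using in_int_span_halve_iff[where b = b, OF assms(1) eG ind j b, of "(\<lambda>_. 0)(j := 1)"]
        int_comb_unit[OF eG j(1)] by simp
    show "e ` {..<n} \<inter> ?N \<subseteq> (e(j := int_comb n e b)) ` {..<n}"
      using ejN by (auto simp: image_iff)
    fix a assume a: "a \<in> e ` {..<n}" "a \<notin> ?N"
    have "a = e j"
    proof -
      obtain i where i: "i < n" "a = e i" using a by auto
      have "i = j"
      proof (rule ccontr)
        assume "i \<noteq> j"
        then have "a \<in> ?N"
          using int_span_incl[OF e' i(1)] i by (simp add: e'_def x_def)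
        then show False using a by simp
      qed
      then show ?thesis using i by simp
    qed
    \<comment> \<open>The two sections of \<open>e j\<close> are \<open>x\<close>, the new
      generator, and \<open>e l\<close>, which is still in the tuple: this is why the square is
      divided by \<open>e l\<close>.\<close>
    have 1: "a \<otimes> (x \<otimes> inv (e j)) = x" unfolding \<open>a = e j\<close>
      using xG eiG[of j] by (metis inv_closed m_assoc m_comm r_inv r_one)
    have "a \<otimes> inv (x \<otimes> inv (e j)) = e j \<otimes> (e j \<otimes> inv x)"
      unfolding \<open>a = e j\<close> using xG eiG by (simp add: inv_mult_group)
    also have "\<dots> = e j [^] (2::int) \<otimes> inv x"
      using xG eiG int_pow_mult[OF eiG, of j 1 1] by (simp add: m_assoc)
    also have "\<dots> = e l"
      unfolding x using eiG by (simp add: inv_mult_group m_assoc[symmetric])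
        (simp add: m_assoc m_lcomm)
    finally have 2: "a \<otimes> inv (x \<otimes> inv (e j)) = e l" .
    show "a \<otimes> (int_comb n e b \<otimes> inv (e j)) \<in> (e(j := int_comb n e b)) ` {..<n} \<and>
        a \<otimes> inv (int_comb n e b \<otimes> inv (e j)) \<in> (e(j := int_comb n e b)) ` {..<n}"
      unfolding x_def[symmetric] 1 2 using l j by (auto simp: image_iff)
  qed
  moreover have "if even (v j)
      then \<exists>v'. int_comb n e v = int_comb n e' v' \<and> v' j = v j div 2 \<and>
        (e j [^] v j \<noteq> \<one> \<longrightarrow> e' j [^] v' j \<noteq> \<one>)
      else int_comb n e v \<notin> int_span n e'" for v
  proof (cases "even (v j)")
    case True
    define v' where "v' = (\<lambda>i. v i - v j div 2 * b i)(j := v j div 2)"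
    have "int_comb n e' v' = int_comb n e (\<lambda>i. (v'(j := 0)) i + v' j * b i)"
      unfolding e'_def x_def by (rule int_comb_fun_upd_comb[OF eG j(1)])
    also have "\<dots> = int_comb n e v"
      by (rule int_comb_cong) (use eG b True in \<open>auto simp: v'_def\<close>)
    finally have "int_comb n e v = int_comb n e' v'" by simp
    moreover have "e j [^] v j \<noteq> \<one> \<longrightarrow> e' j [^] v' j \<noteq> \<one>"
      using x_pow[of "v j div 2"] True by (auto simp: e'_def v'_def)
    ultimately show ?thesis using True by (auto simp: v'_def)
  next
    case False
    then show ?thesis
      using in_int_span_halve_iff[where b = b, OF assms(1) eG ind j b] by (simp add: e'_def x_def)
  qed
  ultimately show ?thesis by blast
qed

definition split_step :: "nat \<Rightarrow> (nat \<Rightarrow> 'a) \<Rightarrow> (nat \<Rightarrow> 'a) \<Rightarrow> bool" where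
  "split_step n e e' \<longleftrightarrow> splittable n e \<and> splittable n e' \<and> tuple_step n e e'"

lemma image_in_span: "range e \<subseteq> carrier G \<Longrightarrow> e ` {..<n} \<subseteq> int_span n e"
  using int_span_incl by auto

lemma split_step_refl: "splittable n e \<Longrightarrow> split_step n e e"
  unfolding split_step_def
  by (auto simp: splittable_def intro!: halving_step_refl subgroup_int_span image_in_span)

text \<open>Splitting the \<open>j\<close>-th generator halves the \<open>j\<close>-th coordinate of a fixed element until it is odd.\<close>

lemma split_path:
  assumes "torsion_two_primary" "n \<ge> 2" "splittable n e" "j < n" "e j [^] v j \<noteq> \<one>"
  shows "\<exists>ys. successively (split_step n) (e # ys) \<and> splittable n (last (e # ys)) \<and>
     int_comb n e v \<notin> int_span n (last (e # ys))"
  using assms(3,5)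
\<comment> \<open>Each halving decreases the absolute value of the coordinate, which never reaches 0
  because its power of the generator stays nontrivial; so it becomes odd eventually.\<close>
proof (induction "nat \<bar>v j\<bar>" arbitrary: e v rule: less_induct)
  case less
  have "e j \<noteq> \<one>" "v j \<noteq> 0" using less.prems(2) by (metis int_pow_one, metis int_pow_0)
  obtain e' where e': "splittable n e'" "tuple_step n e e'"
    and v: "\<And>v. if even (v j)
      then \<exists>v'. int_comb n e v = int_comb n e' v' \<and> v' j = v j div 2 \<and>
        (e j [^] v j \<noteq> \<one> \<longrightarrow> e' j [^] v' j \<noteq> \<one>)
      else int_comb n e v \<notin> int_span n e'"
    using splittable_step[OF assms(1) less.prems(1) assms(2,4) \<open>e j \<noteq> \<one>\<close>] by blast
  have step: "split_step n e e'" using less.prems e' by (simp add: split_step_def)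
  show ?case
  proof (cases "even (v j)")
    case True
    then obtain v' where v': "int_comb n e v = int_comb n e' v'" "v' j = v j div 2"
        "e' j [^] v' j \<noteq> \<one>"
      using v[of v] less.prems(2) by auto
    have "nat \<bar>v' j\<bar> < nat \<bar>v j\<bar>" using v'(2) \<open>v j \<noteq> 0\<close> True by auto
    from less.hyps[where v = v', OF this e'(1) v'(3)] obtain ys where
      "successively (split_step n) (e' # ys)" "splittable n (last (e' # ys))"
      "int_comb n e' v' \<notin> int_span n (last (e' # ys))" by blast
    then show ?thesis using step v'(1) by (intro exI[of _ "e' # ys"]) simp
  next
    case False
    then show ?thesis using step v[of v] e'(1) by (intro exI[of _ "[e']"]) simp
  qed
qed

lemma chain_state_tuple:
  assumes "range e \<subseteq> carrier G" "n > 0"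
  shows "chain_state n (e ` {..<n}) (int_span n e)"
  unfolding chain_state_def
  using assms card_image_le[of "{..<n}" e] by (auto simp: subgroup_int_span int_span_incl)

text \<open>
  The group is countable, so a diagonal construction expels its nontrivial elements one after the
  other; \<open>P k xs\<close> says that the finite path \<open>xs\<close> has dealt with the first \<open>k\<close> of them.
\<close>

lemma starts_chain_splittable:
  assumes "torsion_two_primary" and n: "n \<ge> 2" and e: "splittable n e"
  shows "starts_chain n (e ` {..<n}) (int_span n e)"
proof -
  have eG: "range e \<subseteq> carrier G" using e by (simp add: splittable_def)
  \<comment> \<open>Integer lists are countable and serve as coefficient vectors; each element of
    the span has such a list of length \<open>n\<close>.\<close>
  define g where "g k = int_comb n e (\<lambda>i. (from_nat k :: int list) ! i)" for k
  have g: "\<exists>k. g k = a" if a: "a \<in> int_span n e" for a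
  proof -
    obtain v where v: "a = int_comb n e v" using a by (auto simp: int_span_def)
    have "g (to_nat (map v [0..<n])) = a"
      unfolding g_def v by (rule int_comb_cong) (use eG in auto)
    then show ?thesis by blast
  qed
  \<comment> \<open>\<open>k < length xs\<close> makes the paths grow, so that a \<open>k\<close>-th
    entry exists at stage \<open>k\<close>; stage \<open>Suc i\<close> deals with
    \<open>g i\<close>.\<close>
  define P where "P k xs \<longleftrightarrow> xs \<noteq> [] \<and> hd xs = e \<and> successively (split_step n) xs \<and> splittable n (last xs)
      \<and> k < length xs \<and> (\<forall>i. k = Suc i \<longrightarrow> g i = \<one> \<or> g i \<notin> int_span n (last xs))" for k xs
  have "\<exists>f. \<forall>k. P k (f k) \<and> (\<exists>zs. f (Suc k) = f k @ zs)"
  proof (rule dependent_nat_choice)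
    show "\<exists>xs. P 0 xs" using e by (intro exI[of _ "[e]"]) (simp add: P_def)
    fix xs k assume P: "P k xs"
    show "\<exists>ys. P (Suc k) ys \<and> (\<exists>zs. ys = xs @ zs)"
    proof (cases "g k = \<one> \<or> g k \<notin> int_span n (last xs)")
      case True
      \<comment> \<open>Nothing is to be expelled; an idle step supplies the additional
        length.\<close>
      then have "P (Suc k) (xs @ [last xs])"
        using P split_step_refl by (auto simp: P_def successively_append_iff)
      then show ?thesis by blast
    next
      case False
      then obtain v where v: "g k = int_comb n (last xs) v" by (auto simp: int_span_def)
      have "\<exists>j<n. last xs j [^] v j \<noteq> \<one>"
      proof (rule ccontr)
        assume "\<not> ?thesis"
        then have "int_comb n (last xs) v = \<one>"
          unfolding int_comb_def by (intro finprod_one_eqI) auto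
        then show False using False v by simp
      qed
      then obtain j where "j < n" "last xs j [^] v j \<noteq> \<one>" by blast
      from split_path[where v = v and e = "last xs", OF assms(1) n _ this] P obtain ys where
        "successively (split_step n) (last xs # ys)" "splittable n (last (last xs # ys))"
        "int_comb n (last xs) v \<notin> int_span n (last (last xs # ys))" by (auto simp: P_def)
      \<comment> \<open>Repeating \<open>last xs\<close> lengthens the path even if
        \<open>ys\<close> is empty.\<close>
      then have "P (Suc k) (xs @ last xs # ys)"
        using P v split_step_refl by (auto simp: P_def successively_append_iff)
      then show ?thesis by blast
    qed
  qed
  then obtain X where X: "\<And>k. P k (X k)" "\<And>k. \<exists>zs. X (Suc k) = X k @ zs" by blast
  have prefix: "\<exists>zs. X m = X k @ zs" if "k \<le> m" for k m
    using that
  proof (induction m rule: dec_induct)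
    case (step m)
    then show ?case using X(2)[of m] by auto
  qed simp
  have len: "k < length (X k)" for k using X(1)[of k] by (simp add: P_def)
  \<comment> \<open>The diagonal: from stage \<open>k\<close> on, all paths share their
    \<open>k\<close>-th entry.\<close>
  define t where "t k = X k ! k" for k
  have nth: "X m ! k = t k" if "k < length (X m)" for m k
  proof (cases "k \<le> m")
    case True
    then show ?thesis using prefix[OF True] len[of k] by (auto simp: t_def nth_append)
  next
    case False
    then show ?thesis using prefix[of m k] that by (auto simp: t_def nth_append)
  qed
  have t: "split_step n (t k) (t (Suc k))" for k
  proof -
    have "successively (split_step n) (X (Suc k))" using X(1)[of "Suc k"] by (simp add: P_def)
    then have "split_step n (X (Suc k) ! k) (X (Suc k) ! Suc k)"
      using len[of "Suc k"] by (rule successively_nth)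
    then show ?thesis using nth len[of "Suc k"] by simp
  qed
  have t0: "t 0 = e" using X(1)[of 0] hd_conv_nth[of "X 0"] by (simp add: P_def t_def)
  have tG: "range (t k) \<subseteq> carrier G" for k using t[of k] by (simp add: split_step_def splittable_def)
  have "a = \<one>" if a: "\<And>k. a \<in> int_span n (t k)" for a
  proof -
    obtain k where k: "g k = a" using g a[of 0] t0 by auto
    \<comment> \<open>The last tuple of stage \<open>Suc k\<close> occurs in \<open>t\<close>; an
      element of all spans lies in its span, hence is trivial by \<open>P\<close>.\<close>
    have "X (Suc k) \<noteq> []" using len[of "Suc k"] by auto
    then have "last (X (Suc k)) = t (length (X (Suc k)) - 1)"
      using nth[of "length (X (Suc k)) - 1" "Suc k"] len[of "Suc k"] by (simp add: last_conv_nth)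
    then show ?thesis using X(1)[of "Suc k"] a k by (auto simp: P_def)
  qed
  then have "(\<Inter>k. int_span n (t k)) \<subseteq> {\<one>}" by (intro subsetI) simp
  moreover have "\<one> \<in> int_span n (t k)" for k
    by (rule subgroup.one_closed[OF subgroup_int_span[OF tG]])
  ultimately have "(\<Inter>k. int_span n (t k)) = {\<one>}" by blast
  then have "halving_chain n (\<lambda>k. t k ` {..<n}) (\<lambda>k. int_span n (t k))"
    using t tG chain_state_tuple n by (simp add: halving_chain_def split_step_def)
  then show ?thesis
    unfolding starts_chain_def using t0 by (intro exI conjI) auto
qed

text \<open>
  With \<open>e j\<close> replaced by \<open>e i \<otimes> e j\<close> among the generators, the shift \<open>d = e j\<close> leads to
  \<open>e i\<close> and \<open>e i \<otimes> e j [^] 2\<close>. Once the power of \<open>e j\<close> is trivial, a state is free for \<open>\<one>\<close>.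
\<close>

lemma starts_chain_finite_order:
  assumes "torsion_two_primary" and n: "n \<ge> 2" and "range e \<subseteq> carrier G" "independent n e"
    and ij: "i < n" "j < n" "i \<noteq> j" and "e j [^] (2 ^ k :: int) = \<one>"
  shows "starts_chain n (insert (e i \<otimes> e j) (e ` ({..<n} - {j}))) (int_span n e)"
  using assms(3,4,8)
proof (induction k arbitrary: e)
  case (0 e)
  have eG: "e i \<in> carrier G" for i using 0 by auto
  \<comment> \<open>Now the product is just \<open>e i\<close>; an idle step adds
    \<open>e j = \<one>\<close> to the states and leads to a splittable tuple.\<close>
  have "e j = \<one>" using 0(3) eG by simp
  then have E: "insert (e i \<otimes> e j) (e ` ({..<n} - {j})) \<subseteq> e ` {..<n}" (is "?E \<subseteq> _")
    using ij eG by auto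
  then have EN: "?E \<subseteq> int_span n e" using image_in_span[OF 0(1), of n] by blast
  show ?case
  proof (rule starts_chain_Cons)
    have "card ?E \<le> n" using card_mono[OF _ E] card_image_le[of "{..<n}" e] by simp
    then show "chain_state n ?E (int_span n e)"
      using EN subgroup_int_span[OF 0(1)] by (simp add: chain_state_def)
    show "halving_step ?E (int_span n e) (e ` {..<n}) (int_span n e)"
      using subgroup_int_span[OF 0(1)] E EN by (rule halving_step_refl)
    show "starts_chain n (e ` {..<n}) (int_span n e)"
      using 0 \<open>e j = \<one>\<close> ij by (intro starts_chain_splittable assms) (auto simp: splittable_def)
  qed
next
  case (Suc k e)
  show ?case
  proof (cases "e j = \<one>")
    case True
    then have "e j [^] (2 ^ k :: int) = \<one>" by simp
    then show ?thesis using Suc by blast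
  next
    case ne: False
    note e = Suc.prems(1,2)
    have eG: "e i \<in> carrier G" for i using e by auto
    define b :: "nat \<Rightarrow> int" where "b = (\<lambda>_. 0)(j := 2)"
    have b: "b j = 2" by (simp add: b_def)
    have x: "int_comb n e b = e j \<otimes> e j"
      unfolding b_def int_comb_single[OF e(1) ij(2)] using int_pow_mult[OF eG, of j 1 1] eG by simp
    define e' where "e' = e(j := int_comb n e b)"
    have e': "range e' \<subseteq> carrier G" using e(1) by (auto simp: e'_def)
    let ?E = "insert (e i \<otimes> e j) (e ` ({..<n} - {j}))"
    let ?E' = "insert (e' i \<otimes> e' j) (e' ` ({..<n} - {j}))"
    have d: "int_comb n e b \<otimes> inv (e j) = e j" unfolding x using eG by (simp add: m_assoc)
    have eq: "?E' = insert (e i \<otimes> (e j \<otimes> e j)) (e ` ({..<n} - {j}))"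
      using ij by (auto simp: e'_def x)
    show ?thesis
    proof (rule starts_chain_Cons)
      have "card (e ` ({..<n} - {j})) \<le> n - 1"
        using card_image_le[of "{..<n} - {j}" e] ij by simp
      then have "card ?E \<le> n" using n by (intro card_insert_le_m1) auto
      moreover have "e i \<otimes> e j \<in> int_span n e"
        using ij int_span_incl[OF e(1)] by (intro subgroup.m_closed[OF subgroup_int_span[OF e(1)]])
      ultimately show "chain_state n ?E (int_span n e)"
        using image_in_span[OF e(1), of n] subgroup_int_span[OF e(1)] by (auto simp: chain_state_def)
      \<comment> \<open>The product has coordinate 1 at \<open>j\<close>; by \<open>in_span\<close>
        it is the only state outside the halved span, so only its sections must be checked.\<close>
      have "int_comb n e (\<lambda>k. ((\<lambda>_. 0)(i := 1)) k + ((\<lambda>_. 0)(j := 1)) k) = e i \<otimes> e j"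
        by (simp only: int_comb_add[OF e(1)] int_comb_unit[OF e(1)] ij)
      then have notin: "e i \<otimes> e j \<notin> int_span n e'"
        using in_int_span_halve_iff[where b = b, OF assms(1) e ij(2) ne b,
            of "\<lambda>k. ((\<lambda>_. 0)(i := 1)) k + ((\<lambda>_. 0)(j := 1)) k"] ij
        by (simp add: e'_def)
      have in_span: "e k \<in> int_span n e'" if "k < n" "k \<noteq> j" for k
        using int_span_incl[OF e' that(1)] that by (simp add: e'_def)
      show "halving_step ?E (int_span n e) ?E' (int_span n e')"
        unfolding e'_def
      proof (rule halving_step_halve[where b = b, OF assms(1) e ij(2) ne b], unfold e'_def[symmetric] d)
        show "?E \<inter> int_span n e' \<subseteq> ?E'" using notin unfolding eq by blast
        fix a assume "a \<in> ?E" "a \<notin> int_span n e'"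
        then have "a = e i \<otimes> e j" using in_span by auto
        then have "a \<otimes> e j = e i \<otimes> (e j \<otimes> e j)" "a \<otimes> inv (e j) = e i"
          using eG by (simp_all add: m_assoc)
        then show "a \<otimes> e j \<in> ?E' \<and> a \<otimes> inv (e j) \<in> ?E'"
          unfolding eq using ij by auto
      qed
      show "starts_chain n ?E' (int_span n e')"
      proof (rule Suc.IH[OF e'])
        show "independent n e'"
          unfolding e'_def
          by (rule independent_halve[where b = b, OF e ij(2) b]) (simp add: b_def)
        have "e j \<otimes> e j = e j [^] (2::int)" using int_pow_mult[OF eG, of j 1 1] eG by simp
        then show "e' j [^] (2 ^ k :: int) = \<one>"
          using Suc.prems(3) eG by (simp add: e'_def x int_pow_pow)
      qed
    qed
  qed
qed

text \<open>A basis of elements of infinite order is splittable. Otherwise some \<open>e j\<close>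
  has 2-power order, and replacing it by \<open>e i \<otimes> e j\<close> keeps a generating set, as
  \<open>e i\<close> remains available to recover it.\<close>

lemma starts_chain_if_torsion_two_primary:
  assumes "torsion_two_primary" and n: "n \<ge> 2" and f: "range f \<subseteq> carrier G" "int_span n f = carrier G"
  shows "\<exists>E. starts_chain n E (carrier G) \<and> generate G E = carrier G"
proof -
  obtain e where e: "range e \<subseteq> carrier G" "int_span n e = carrier G" "independent n e"
    using independent_basis_exists[OF f(1), of n] f(2) by auto
  have eG: "e i \<in> carrier G" for i using e by auto
  show ?thesis
  proof (cases "\<forall>j<n. \<forall>m::int. e j [^] m = \<one> \<longrightarrow> m = 0")
    case True
    then have "splittable n e" using e by (simp add: splittable_def)
    then show ?thesis
      using starts_chain_splittable[OF assms(1) n] generate_eq_int_span[OF e(1), of n] e(2) by metis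
  next
    case False
    then obtain j m where j: "j < n" "m \<noteq> (0::int)" "e j [^] m = \<one>" by blast
    then obtain k where k: "e j [^] (2 ^ k :: int) = \<one>"
      using assms(1) eG unfolding torsion_two_primary_def by blast
    define i where "i = (if j = 0 then 1 else 0 :: nat)"
    have i: "i < n" "i \<noteq> j" using n by (auto simp: i_def)
    let ?E = "insert (e i \<otimes> e j) (e ` ({..<n} - {j}))"
    have E: "?E \<subseteq> carrier G" using eG by auto
    have "e l \<in> generate G ?E" if "l < n" for l
    proof (cases "l = j")
      case True
      have "inv (e i) \<otimes> (e i \<otimes> e j) \<in> generate G ?E"
        using i by (intro generate.eng generate.inv generate.incl) auto
      then show ?thesis using True eG by (simp add: m_assoc[symmetric])
    qed (use that in \<open>auto intro: generate.incl\<close>)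
    then have "carrier G \<subseteq> generate G ?E"
      unfolding e(2)[symmetric] using e(1) generate_is_subgroup[OF E] by (intro int_span_least)
    then have "generate G ?E = carrier G" using generate_incl[OF E] by blast
    then show ?thesis
      using starts_chain_finite_order[OF assms(1) n e(1,3) i(1) j(1) i(2) k] e(2) by auto
  qed
qed

end

lemma generated_by_tv_automaton_if_starts_chain:
  fixes G :: "'a monoid"
  assumes "comm_group G" "comm_group.starts_chain G n E (carrier G)" "generate G E = carrier G"
  shows "generated_by_tv_automaton n {0, 1 :: nat} G"
proof -
  interpret comm_group G by fact
  obtain S M where "S 0 = E" "M 0 = carrier G" "halving_chain n S M"
    using assms(2) by (auto simp: starts_chain_def)
  then interpret chain_automaton G n S M by unfold_locales
  show ?thesis
    using \<open>S 0 = E\<close> \<open>M 0 = carrier G\<close> assms(3) by (intro generated_by_halving_chain) auto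
qed

section \<open>Torsion of binary tree automorphisms\<close>

lemma tree_automorphism_adjacent:
  "f \<in> tree_automorphisms X \<Longrightarrow> u \<in> lists X \<Longrightarrow> v \<in> lists X \<Longrightarrow>
    word_adjacent X (f u) (f v) \<longleftrightarrow> word_adjacent X u v"
  by (simp add: tree_automorphisms_def)

text \<open>Images of child and parent are adjacent. The child cannot go upwards, since that place
  is taken by the image of the grandparent; at the root there is no way up.\<close>

lemma tree_automorphism_append:
  assumes f: "f \<in> tree_automorphisms X" and "w \<in> lists X" "x \<in> X"
  shows "\<exists>y\<in>X. f (w @ [x]) = f w @ [y]"
  using assms(2,3)
proof (induction w arbitrary: x rule: rev_induct)
  case Nil
  then have "word_adjacent X [] [x]" by (auto simp: word_adjacent_def)
  then have "word_adjacent X (f []) (f [x])" using tree_automorphism_adjacent[OF f, of "[]" "[x]"] Nil by simp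
  then show ?case using f by (auto simp: tree_automorphisms_def word_adjacent_def)
next
  case (snoc z w)
  then have w: "w \<in> lists X" "z \<in> X" by auto
  then have "word_adjacent X (w @ [z]) (w @ [z, x])"
    using snoc.prems(2) by (auto simp: word_adjacent_def)
  then have "word_adjacent X (f (w @ [z])) (f (w @ [z, x]))"
    using tree_automorphism_adjacent[OF f, of "w @ [z]" "w @ [z, x]"] snoc.prems by simp
  moreover have "f (w @ [z]) \<noteq> f (w @ [z, x]) @ [y]" for y
  proof
    assume "f (w @ [z]) = f (w @ [z, x]) @ [y]"
    then have "f (w @ [z, x]) = f w" using snoc.IH[OF w] by auto
    moreover have "inj_on f (lists X)" using f by (auto simp: tree_automorphisms_def Bij_def bij_betw_def)
    ultimately have "w @ [z, x] = w" using w snoc.prems by (auto dest!: inj_onD)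
    then show False by simp
  qed
  ultimately show ?case by (auto simp: word_adjacent_def)
qed

lemma tree_automorphism_closed:
  "f \<in> tree_automorphisms X \<Longrightarrow> w \<in> lists X \<Longrightarrow> f w \<in> lists X"
  unfolding tree_automorphisms_def Bij_def by (blast dest: bij_betw_apply)

text \<open>By induction the power \<open>2 ^ k\<close> fixes the parent of a word of length
  \<open>Suc k\<close>, hence permutes its two children, and its square fixes them.\<close>

lemma funpow_two_power_fixes_level:
  assumes f: "f \<in> tree_automorphisms {0, 1 :: nat}" and "w \<in> lists {0, 1}" "length w = k"
  shows "(f ^^ (2 ^ k)) w = w"
  using assms(2,3)
proof (induction k arbitrary: w)
  case 0
  then show ?case using f by (auto simp: tree_automorphisms_def)
next
  case (Suc k)
  obtain u x where w: "w = u @ [x]" using Suc.prems(2) by (metis length_Suc_conv_rev)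
  have u: "u \<in> lists {0, 1}" "length u = k" and x: "x \<in> {0, 1}"
    using Suc.prems w by auto
  let ?h = "f ^^ (2 ^ k)"
  have append: "\<exists>y\<in>{0, 1}. (f ^^ m) (v @ [x]) = (f ^^ m) v @ [y] \<and> (f ^^ m) v \<in> lists {0, 1}"
    if "v \<in> lists {0, 1}" "x \<in> {0, 1}" for m v and x :: nat
    using that
  proof (induction m)
    case (Suc m)
    then obtain y where "y \<in> {0, 1}" "(f ^^ m) (v @ [x]) = (f ^^ m) v @ [y]"
      "(f ^^ m) v \<in> lists {0, 1}" by blast
    then show ?case
      using tree_automorphism_append[OF f, of "(f ^^ m) v" y] tree_automorphism_closed[OF f] by auto
  qed auto
  have inj: "inj_on (f ^^ m) (lists {0, 1})" for m
  proof (induction m)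
    case (Suc m)
    have "inj_on f (lists {0, 1})" using f by (auto simp: tree_automorphisms_def Bij_def bij_betw_def)
    moreover have "(f ^^ m) v \<in> lists {0, 1}" if "v \<in> lists {0, 1}" for v
      using append[OF that, of 0 m] by auto
    ultimately show ?case using Suc by (auto simp: inj_on_def)
  qed simp
  have h: "\<exists>y\<in>{0, 1}. ?h (u @ [x]) = u @ [y]" if "x \<in> {0, 1}" for x
    using append[OF u(1) that, of "2 ^ k"] Suc.IH[OF u] by auto
  obtain y where y: "y \<in> {0, 1}" "?h (u @ [x]) = u @ [y]" using h[OF x] by blast
  have "?h (?h w) = w"
  proof (cases "y = x")
    case True
    then show ?thesis using y w by simp
  next
    case False
    obtain z where z: "z \<in> {0, 1}" "?h (u @ [y]) = u @ [z]" using h[OF y(1)] by blast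
    have "z \<noteq> y"
    proof
      assume "z = y"
      then have "?h (u @ [x]) = ?h (u @ [y])" using y z by simp
      then have "u @ [x] = u @ [y]"
        using inj[of "2 ^ k"] u x y(1) by (auto dest!: inj_onD)
      then show False using False by simp
    qed
    then have "z = x" using False x y(1) z(1) by auto
    then show ?thesis using w y z by simp
  qed
  then show ?case by (simp add: mult_2 funpow_add)
qed

section \<open>Torsion in the automorphism group of the binary tree\<close>

lemma tree_aut_group_simps [simp]:
  "carrier (tree_aut_group X) = tree_automorphisms X"
  "\<one>\<^bsub>tree_aut_group X\<^esub> = (\<lambda>w\<in>lists X. w)"
  by (simp_all add: tree_aut_group_def BijGroup_def)

lemma tree_aut_group_mult:
  assumes "f \<in> tree_automorphisms X" "g \<in> tree_automorphisms X"
  shows "f \<otimes>\<^bsub>tree_aut_group X\<^esub> g = compose (lists X) f g"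
  using assms by (simp add: tree_aut_group_def BijGroup_def tree_automorphisms_def)

lemma tree_aut_group_pow:
  assumes f: "f \<in> tree_automorphisms X" and w: "w \<in> lists X"
  shows "(f [^]\<^bsub>tree_aut_group X\<^esub> (n::nat)) w = (f ^^ n) w"
  using w
proof (induction n arbitrary: w)
  case (Suc n)
  interpret group "tree_aut_group X" by (rule group_tree_aut_group)
  have "f [^]\<^bsub>tree_aut_group X\<^esub> n \<in> tree_automorphisms X" using nat_pow_closed[of f n] f by simp
  then show ?case
    using Suc tree_automorphism_closed[OF f Suc.prems] f
    by (simp add: tree_aut_group_mult compose_def funpow_swap1)
qed simp

text \<open>With \<open>m = 2 ^ a * b\<close> and \<open>b\<close> odd, \<open>h\<close> is the
  power \<open>2 ^ a\<close> of \<open>f\<close> and satisfies \<open>h [^] b = \<one>\<close>. On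
  words of length \<open>k\<close> its power \<open>2 ^ k\<close> is trivial as well, so by
  coprimality \<open>h\<close> fixes every word.\<close>

lemma tree_aut_group_torsion:
  fixes m :: nat
  assumes f: "f \<in> tree_automorphisms {0, 1 :: nat}" and m: "m > 0"
    and fm: "f [^]\<^bsub>tree_aut_group {0, 1}\<^esub> m = \<one>\<^bsub>tree_aut_group {0, 1}\<^esub>"
  shows "\<exists>k::nat. f [^]\<^bsub>tree_aut_group {0, 1}\<^esub> (2 ^ k :: nat) = \<one>\<^bsub>tree_aut_group {0, 1}\<^esub>"
proof -
  let ?T = "tree_aut_group {0, 1 :: nat}"
  interpret T: group ?T by (rule group_tree_aut_group)
  have "\<exists>a b. m = 2 ^ a * b \<and> odd b"
    using m
  proof (induction m rule: less_induct)
    case (less m)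
    show ?case
    proof (cases "odd m")
      case True
      then show ?thesis by (intro exI[of _ 0] exI[of _ m]) simp
    next
      case False
      then obtain l where l: "m = 2 * l" by (auto elim: evenE)
      moreover have "l < m" "0 < l" using l less.prems by auto
      ultimately obtain a b where "l = 2 ^ a * b" "odd b" using less.IH by blast
      then show ?thesis using l by (intro exI[of _ "Suc a"] exI[of _ b]) simp
    qed
  qed
  then obtain a b where ab: "m = 2 ^ a * b" "odd b" by blast
  define h where "h = f [^]\<^bsub>?T\<^esub> (2 ^ a :: nat)"
  have h: "h \<in> tree_automorphisms {0, 1}" using T.nat_pow_closed[of f "2 ^ a"] f by (simp add: h_def)
  have hb: "h [^]\<^bsub>?T\<^esub> b = \<one>\<^bsub>?T\<^esub>" using fm f ab T.nat_pow_pow[of f "2 ^ a" b] by (simp add: h_def)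
  have "h w = w" if w: "w \<in> lists {0, 1}" for w
  proof -
    define k where "k = length w"
    \<comment> \<open>Since \<open>x\<close> inverts \<open>2 ^ k\<close> modulo \<open>b\<close>,
      \<open>h\<close> equals its power \<open>2 ^ k * x\<close>; \<open>q\<close> and
      \<open>r\<close> keep all exponents natural.\<close>
    have "coprime (2 ^ k) b" using ab by simp
    then obtain x where "[2 ^ k * x = Suc 0] (mod b)" using cong_solve_coprime_nat by blast
    then obtain q r where qr: "b * q + 2 ^ k * x = b * r + 1"
      unfolding cong_iff_lin_nat by (metis One_nat_def add.commute mult.commute)
    have "h [^]\<^bsub>?T\<^esub> (b * q + 2 ^ k * x) = h [^]\<^bsub>?T\<^esub> (b * r + 1)" by (simp only: qr)
    moreover have "h [^]\<^bsub>?T\<^esub> (b * q + l) = h [^]\<^bsub>?T\<^esub> l" for q l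
    proof -
      have hT: "h \<in> carrier ?T" using h by simp
      have "h [^]\<^bsub>?T\<^esub> (b * q) = \<one>\<^bsub>?T\<^esub>"
        using T.nat_pow_pow[OF hT, of b q] hb T.nat_pow_one[of q] by metis
      then show ?thesis
        using T.nat_pow_mult[OF hT, of "b * q" l] T.l_one[OF T.nat_pow_closed[OF hT, of l]] by metis
    qed
    ultimately have "h [^]\<^bsub>?T\<^esub> (2 ^ k * x) = h [^]\<^bsub>?T\<^esub> (1::nat)" by metis
    then have "h [^]\<^bsub>?T\<^esub> (2 ^ k * x) = h" using h T.nat_pow_eone[of h] by simp
    then have "h w = (h ^^ (2 ^ k * x)) w" using tree_aut_group_pow[OF h w] by metis
    also have "\<dots> = w"
    proof -
      have "(h ^^ (2 ^ k)) w = w" using funpow_two_power_fixes_level[OF h w] by (simp add: k_def)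
      then have "((h ^^ (2 ^ k)) ^^ x) w = w" by (induction x) auto
      then show ?thesis by (simp add: funpow_mult mult.commute)
    qed
    finally show ?thesis .
  qed
  moreover have "h \<in> extensional (lists {0, 1})" using h by (simp add: tree_automorphisms_def Bij_def)
  ultimately have "h = \<one>\<^bsub>?T\<^esub>" by (auto simp: fun_eq_iff extensional_def restrict_def)
  then show ?thesis unfolding h_def by blast
qed

text \<open>The isomorphism is used both ways: \<open>\<psi>\<close> carries the states to
  generators of \<open>G\<close>, \<open>\<phi>\<close> carries torsion elements of \<open>G\<close>
  into the tree.\<close>

lemma generated_by_tv_automatonD:
  fixes G :: "'a monoid"
  assumes "group G" and "generated_by_tv_automaton n {0, 1 :: nat} G"
  shows "\<exists>S. finite S \<and> card S \<le> n \<and> S \<subseteq> carrier G \<and> generate G S = carrier G \<and>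
      (n = 1 \<longrightarrow> (\<exists>g. S = {g} \<and> g \<otimes>\<^bsub>G\<^esub> g = \<one>\<^bsub>G\<^esub>))"
    and "\<And>x m::nat. x \<in> carrier G \<Longrightarrow> m > 0 \<Longrightarrow> x [^]\<^bsub>G\<^esub> m = \<one>\<^bsub>G\<^esub> \<Longrightarrow>
      \<exists>k::nat. x [^]\<^bsub>G\<^esub> (2 ^ k :: nat) = \<one>\<^bsub>G\<^esub>"
proof -
  interpret G: group G by fact
  obtain A :: "(nat, nat) tv_automaton" where A: "invertible_tv_automaton A" "card (states A) = n"
    "alphabet A = {0, 1}" "G \<cong> automaton_group A"
    using assms(2) unfolding generated_by_tv_automaton_def by blast
  interpret A: invertible_tv_automaton A by fact
  let ?T = "tree_aut_group {0, 1 :: nat}" and ?K = "state_aut A 1 ` states A"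
  interpret T: group ?T by (rule group_tree_aut_group)
  have K: "?K \<subseteq> carrier ?T" using A.state_aut_in_tree_automorphisms[of 1] A(3) by auto
  define H where "H = generate ?T ?K"
  have H: "subgroup H ?T" unfolding H_def by (rule T.generate_is_subgroup[OF K])
  have AH: "automaton_group A = ?T\<lparr>carrier := H\<rparr>" by (simp add: automaton_group_def H_def A(3))
  let ?H = "?T\<lparr>carrier := H\<rparr>"
  interpret H: group ?H using T.subgroup_imp_group[OF H] .
  obtain \<phi> where \<phi>: "\<phi> \<in> iso G ?H" using A(4) AH by (auto simp: is_iso_def)
  obtain \<psi> where \<psi>: "\<psi> \<in> iso ?H G" using G.iso_sym[OF A(4)] AH by (auto simp: is_iso_def)
  interpret \<phi>: group_hom G ?H \<phi> using \<phi> by unfold_locales (simp add: iso_def)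
  interpret \<psi>: group_hom ?H G \<psi> using \<psi> by unfold_locales (simp add: iso_def)
  have KH: "?K \<subseteq> H" unfolding H_def by (auto intro: generate.incl)
  have "generate G (\<psi> ` ?K) = \<psi> ` generate ?H ?K" using \<psi>.generate_img[of ?K] KH by simp
  also have "generate ?H ?K = H" using T.generate_consistent[OF KH H] by (simp add: H_def)
  also have "\<psi> ` H = carrier G" using \<psi> by (simp add: iso_def bij_betw_def)
  finally have gen: "generate G (\<psi> ` ?K) = carrier G" .
  have "\<exists>g. \<psi> ` ?K = {g} \<and> g \<otimes>\<^bsub>G\<^esub> g = \<one>\<^bsub>G\<^esub>" if n: "n = 1"
  proof -
    \<comment> \<open>A single state always returns to itself, and a permutation of two letters has
      trivial square; hence so has the state.\<close>
    obtain q where q: "states A = {q}" using A(2) n card_1_singletonE by metis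
    have bij: "bij_betw (outp A i q) {0, 1} {0, 1}" if "i \<ge> 1" for i
      using A.outp_bij[OF that, of q] q A(3) by simp
    have inv: "outp A i q (outp A i q x) = x" if i: "i \<ge> 1" and x: "x \<in> {0, 1}" for i x
    proof -
      have "outp A i q 0 \<in> {0, 1}" "outp A i q 1 \<in> {0, 1}"
        using A.outp_closed[OF i, of q] q A(3) by auto
      moreover have "outp A i q 0 \<noteq> outp A i q 1"
        using bij[OF i] by (auto simp: bij_betw_def)
      ultimately show ?thesis using x by auto
    qed
    have act: "state_action A i q (state_action A i q w) = w" if "w \<in> lists {0, 1}" "i \<ge> 1" for w i
      using that
    proof (induction w arbitrary: i rule: list.induct)
      case (Cons x w)
      note i = Cons.prems(2)
      have "trans A i q x = q" if "x \<in> {0, 1}" for x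
        using A.trans_closed[OF i, of q x] q A(3) that by simp
      moreover have "outp A i q x \<in> {0, 1}"
        using A.outp_closed[OF i, of q x] q A(3) Cons.prems(1) by simp
      ultimately show ?case using Cons inv[OF i] by simp
    qed simp
    let ?s = "state_aut A 1 q"
    have s: "?s \<in> tree_automorphisms {0, 1}" "?s \<in> H" using K KH q by auto
    have "?s \<otimes>\<^bsub>?T\<^esub> ?s = \<one>\<^bsub>?T\<^esub>"
    proof -
      have "?s (?s w) = w" if w: "w \<in> lists {0, 1}" for w
        using act[OF w, of 1] tree_automorphism_closed[OF s(1) w] w by (simp add: state_aut_def A(3))
      then show ?thesis
        unfolding tree_aut_group_mult[OF s(1) s(1)] by (auto simp: compose_def restrict_def fun_eq_iff)
    qed
    then have "\<psi> ?s \<otimes>\<^bsub>G\<^esub> \<psi> ?s = \<one>\<^bsub>G\<^esub>"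
      using \<psi>.hom_mult[of ?s ?s] \<psi>.hom_one s(2) by simp
    then show ?thesis using q by auto
  qed
  moreover have "finite (\<psi> ` ?K)" "card (\<psi> ` ?K) \<le> n"
    using A.finite_states card_image_le[of "states A" "\<psi> \<circ> state_aut A 1"] A(2)
    by (auto simp: image_comp)
  moreover have "\<psi> ` ?K \<subseteq> carrier G" using \<psi>.hom_closed KH by auto
  ultimately show "\<exists>S. finite S \<and> card S \<le> n \<and> S \<subseteq> carrier G \<and> generate G S = carrier G \<and>
      (n = 1 \<longrightarrow> (\<exists>g. S = {g} \<and> g \<otimes>\<^bsub>G\<^esub> g = \<one>\<^bsub>G\<^esub>))"
    using gen by blast
  show "\<exists>k::nat. x [^]\<^bsub>G\<^esub> (2 ^ k :: nat) = \<one>\<^bsub>G\<^esub>"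
    if x: "x \<in> carrier G" "m > 0" "x [^]\<^bsub>G\<^esub> m = \<one>\<^bsub>G\<^esub>" for x and m :: nat
  proof -
    have \<phi>x: "\<phi> x \<in> H" using \<phi>.hom_closed[OF x(1)] by simp
    have pow: "\<phi> (x [^]\<^bsub>G\<^esub> l) = \<phi> x [^]\<^bsub>?T\<^esub> l" for l :: nat
      using \<phi>.hom_nat_pow[OF x(1)] T.nat_pow_consistent[of "\<phi> x" l H] by simp
    have one: "\<phi> \<one>\<^bsub>G\<^esub> = \<one>\<^bsub>?T\<^esub>" using \<phi>.hom_one by simp
    have "\<phi> x \<in> tree_automorphisms {0, 1}" using \<phi>x subgroup.subset[OF H] by auto
    from tree_aut_group_torsion[OF this x(2)] obtain k :: nat
      where "\<phi> x [^]\<^bsub>?T\<^esub> (2 ^ k :: nat) = \<one>\<^bsub>?T\<^esub>" using pow[of m] one x(3) by auto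
    then have "\<phi> (x [^]\<^bsub>G\<^esub> (2 ^ k :: nat)) = \<phi> \<one>\<^bsub>G\<^esub>" using pow one by simp
    moreover have "inj_on \<phi> (carrier G)" using \<phi> by (simp add: iso_def bij_betw_def)
    ultimately have "x [^]\<^bsub>G\<^esub> (2 ^ k :: nat) = \<one>\<^bsub>G\<^esub>"
      using x(1) by (meson G.nat_pow_closed G.one_closed inj_onD)
    then show ?thesis by blast
  qed
qed

section \<open>The classes of groups\<close>

context comm_group
begin

section \<open>The torsion subgroup and groups of order at most 2\<close>

lemma subgroup_torsion: "subgroup {x \<in> carrier G. \<exists>m::nat. m > 0 \<and> x [^] m = \<one>} G"
proof (rule subgroupI)
  show "{x \<in> carrier G. \<exists>m::nat. m > 0 \<and> x [^] m = \<one>} \<noteq> {}"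
    by (auto intro!: exI[of _ \<one>] exI[of _ "1::nat"])
  show "inv a \<in> {x \<in> carrier G. \<exists>m::nat. m > 0 \<and> x [^] m = \<one>}"
    if "a \<in> {x \<in> carrier G. \<exists>m::nat. m > 0 \<and> x [^] m = \<one>}" for a
    using that by (auto simp: nat_pow_inv)
  show "a \<otimes> b \<in> {x \<in> carrier G. \<exists>m::nat. m > 0 \<and> x [^] m = \<one>}"
    if a: "a \<in> {x \<in> carrier G. \<exists>m::nat. m > 0 \<and> x [^] m = \<one>}"
      and b: "b \<in> {x \<in> carrier G. \<exists>m::nat. m > 0 \<and> x [^] m = \<one>}" for a b
  proof -
    obtain k l :: nat where k: "k > 0" "a [^] k = \<one>" and l: "l > 0" "b [^] l = \<one>"
      using a b by blast
    have "a [^] (k * l) = (a [^] k) [^] l" "b [^] (k * l) = (b [^] l) [^] k"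
      using a b nat_pow_pow by (simp_all add: mult.commute)
    then have "(a \<otimes> b) [^] (k * l) = \<one>"
      using a b k l by (simp add: nat_pow_distrib)
    then show ?thesis using a b k l by (auto intro!: exI[of _ "k * l"])
  qed
qed auto

lemma generate_involution:
  assumes g: "g \<in> carrier G" "g \<otimes> g = \<one>"
  shows "generate G {g} = {\<one>, g}"
proof
  have "inv g = g" using g by (simp add: inv_equality)
  then have "subgroup {\<one>, g} G" using g by (intro subgroupI) auto
  then show "generate G {g} \<subseteq> {\<one>, g}" by (intro generate_subgroup_incl) auto
  show "{\<one>, g} \<subseteq> generate G {g}" by (auto intro: generate.one generate.incl)
qed

lemma starts_chain_trivial: "starts_chain 1 {\<one>} {\<one>}"
proof -
  have "subgroup {\<one>} G" by (intro subgroupI) auto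
  then have "halving_chain 1 (\<lambda>_. {\<one>}) (\<lambda>_. {\<one>})"
    by (auto simp: halving_chain_def chain_state_def intro: halving_step_refl)
  then show ?thesis unfolding starts_chain_def by (intro exI conjI) auto
qed

text \<open>With a nontrivial \<open>g\<close> itself as shift, both its sections are trivial, so
  one state per time suffices: first \<open>g\<close>, then \<open>\<one>\<close>.\<close>

lemma starts_chain_involution:
  assumes g: "g \<in> carrier G" "g \<otimes> g = \<one>"
  shows "starts_chain 1 {g} {\<one>, g}"
proof (cases "g = \<one>")
  case True
  then show ?thesis using starts_chain_trivial by simp
next
  case False
  show ?thesis
  proof (rule starts_chain_Cons[OF _ _ starts_chain_trivial])
    have "subgroup {\<one>, g} G"
      using generate_is_subgroup[of "{g}"] g by (simp add: generate_involution)
    then show "chain_state 1 {g} {\<one>, g}" by (simp add: chain_state_def)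
    have "inv g = g" using g by (simp add: inv_equality)
    then show "halving_step {g} {\<one>, g} {\<one>} {\<one>}"
      using g False by (auto simp: halving_step_def)
  qed
qed

end

section \<open>Torsion conditions and rank in terms of elements\<close>

lemma two_group_torsion_part_iff:
  fixes G :: "'a monoid" (structure)
  assumes "comm_group G"
  shows "two_group (torsion_part G) \<longleftrightarrow>
    (\<forall>x\<in>carrier G. \<forall>m::nat. m > 0 \<longrightarrow> x [^] m = \<one> \<longrightarrow> (\<exists>k::nat. x [^] (2 ^ k :: nat) = \<one>))"
proof -
  interpret comm_group G by fact
  interpret T: group "torsion_part G"
    unfolding torsion_part_def by (rule subgroup_imp_group[OF subgroup_torsion])
  have pow: "x [^]\<^bsub>torsion_part G\<^esub> k = x [^] k" for x and k :: nat
    unfolding torsion_part_def by (rule nat_pow_consistent[symmetric])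
  have one: "\<one>\<^bsub>torsion_part G\<^esub> = \<one>" by (simp add: torsion_part_def)
  have ord: "(\<exists>k::nat. T.ord x = 2 ^ k) \<longleftrightarrow> (\<exists>k::nat. x [^] (2 ^ k :: nat) = \<one>)"
    if x: "x \<in> carrier (torsion_part G)" for x
  proof
    assume "\<exists>k::nat. T.ord x = 2 ^ k"
    then show "\<exists>k::nat. x [^] (2 ^ k :: nat) = \<one>"
      using T.pow_ord_eq_1[OF x] pow one by metis
  next
    assume "\<exists>k::nat. x [^] (2 ^ k :: nat) = \<one>"
    then obtain k :: nat where "x [^]\<^bsub>torsion_part G\<^esub> (2 ^ k :: nat) = \<one>\<^bsub>torsion_part G\<^esub>"
      using pow one by auto
    then have "T.ord x dvd 2 ^ k" using T.pow_eq_id[OF x] by simp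
    then show "\<exists>k::nat. T.ord x = 2 ^ k"
      using divides_primepow_nat[OF two_is_prime_nat] by blast
  qed
  have "two_group (torsion_part G) \<longleftrightarrow>
      (\<forall>x\<in>carrier (torsion_part G). \<exists>k::nat. x [^] (2 ^ k :: nat) = \<one>)"
    unfolding two_group_def using ord T.group_axioms by auto
  also have "\<dots> \<longleftrightarrow> (\<forall>x\<in>carrier G. \<forall>m::nat. m > 0 \<longrightarrow> x [^] m = \<one> \<longrightarrow>
      (\<exists>k::nat. x [^] (2 ^ k :: nat) = \<one>))"
    by (auto simp: torsion_part_def)
  finally show ?thesis .
qed

lemma torsion_two_primary_iff:
  fixes G :: "'a monoid" (structure)
  assumes "comm_group G"
  shows "comm_group.torsion_two_primary G \<longleftrightarrow> two_group (torsion_part G)"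
proof -
  interpret comm_group G by fact
  have pow: "x [^] (2 ^ k :: int) = x [^] (2 ^ k :: nat)" for x and k :: nat
    using int_pow_int[of G x "2 ^ k"] by simp
  have "(\<forall>m::int. m \<noteq> 0 \<longrightarrow> x [^] m = \<one> \<longrightarrow> P) \<longleftrightarrow> (\<forall>m::nat. m > 0 \<longrightarrow> x [^] m = \<one> \<longrightarrow> P)"
    if x: "x \<in> carrier G" for x P
  proof (intro iffI allI impI)
    fix m :: nat
    assume *: "\<forall>m::int. m \<noteq> 0 \<longrightarrow> x [^] m = \<one> \<longrightarrow> P" and m: "m > 0" "x [^] m = \<one>"
    show P using *[rule_format, of "int m"] m by (simp add: int_pow_int)
  next
    fix m :: int
    assume *: "\<forall>m::nat. m > 0 \<longrightarrow> x [^] m = \<one> \<longrightarrow> P" and m: "m \<noteq> 0" "x [^] m = \<one>"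
    have "x [^] \<bar>m\<bar> = \<one>" using m x by (cases "m \<ge> 0") (auto simp: int_pow_neg)
    then have "x [^] (nat \<bar>m\<bar>) = \<one>" using int_pow_int[of G x "nat \<bar>m\<bar>"] by simp
    then show P using *[rule_format, of "nat \<bar>m\<bar>"] m by simp
  qed
  then show ?thesis
    unfolding two_group_torsion_part_iff[OF assms] torsion_two_primary_def pow by simp
qed

lemma group_rank_le:
  assumes "finite S" "S \<subseteq> carrier G" "generate G S = carrier G"
  shows "finitely_generated G" "group_rank G \<le> card S"
  using assms unfolding finitely_generated_def group_rank_def by (auto intro!: Least_le)

lemma group_rank_witness:
  assumes "finitely_generated G" "group_rank G \<le> n"
  obtains S where "finite S" "S \<subseteq> carrier G" "card S \<le> n" "generate G S = carrier G"
proof -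
  have "\<exists>k S. finite S \<and> S \<subseteq> carrier G \<and> card S = k \<and> generate G S = carrier G"
    using assms(1) by (auto simp: finitely_generated_def)
  from LeastI_ex[OF this] show ?thesis
    using assms(2) that unfolding group_rank_def by auto
qed

section \<open>The identities of the classes\<close>

theorem TVA_1: "(TVA 1 :: 'a monoid set) = EA2 1"
proof (intro equalityI subsetI)
  fix G :: "'a monoid" assume "G \<in> TVA 1"
  then have G: "comm_group G" "generated_by_tv_automaton 1 {0, 1 :: nat} G" by (auto simp: TVA_def)
  interpret comm_group G by fact
  obtain g where g: "g \<in> carrier G" "generate G {g} = carrier G" "g \<otimes>\<^bsub>G\<^esub> g = \<one>\<^bsub>G\<^esub>"
    using generated_by_tv_automatonD(1)[OF group_axioms G(2)] by auto
  have "ord x = 2" if x: "x \<in> carrier G" "x \<noteq> \<one>\<^bsub>G\<^esub>" for x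
  proof -
    have "x = g" using x g generate_involution by auto
    then have "x [^]\<^bsub>G\<^esub> (2::nat) = \<one>\<^bsub>G\<^esub>" using g by (simp add: numeral_2_eq_2)
    then have "ord x dvd 2" using x by (simp add: pow_eq_id)
    moreover have "ord x \<noteq> 1" using x ord_eq_1 by simp
    ultimately show ?thesis using prime_nat_iff two_is_prime_nat by blast
  qed
  then have "elementary_abelian_two_group G"
    using G(1) by (simp add: elementary_abelian_two_group_def)
  then show "G \<in> EA2 1" using group_rank_le[of "{g}" G] g by (simp add: EA2_def)
next
  fix G :: "'a monoid" assume "G \<in> EA2 1"
  then have G: "elementary_abelian_two_group G" and r: "finitely_generated G" "group_rank G \<le> 1"
    by (auto simp: EA2_def)
  interpret comm_group G using G by (simp add: elementary_abelian_two_group_def)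
  obtain S where S: "finite S" "S \<subseteq> carrier G" "card S \<le> 1" "generate G S = carrier G"
    using group_rank_witness[OF r] by blast
  \<comment> \<open>The trivial group may come with the empty generating set, but the single state
    has to act as some generator; the identity serves.\<close>
  have "\<exists>g\<in>carrier G. generate G {g} = carrier G"
  proof (cases "S = {}")
    case True
    then have "carrier G \<subseteq> generate G {\<one>\<^bsub>G\<^esub>}" using S(4) mono_generate[of "{}" "{\<one>\<^bsub>G\<^esub>}"] by simp
    then show ?thesis using generate_incl[of "{\<one>\<^bsub>G\<^esub>}"] by blast
  next
    case False
    then have "card S = 1" using S by (metis One_nat_def Suc_leI card_gt_0_iff le_antisym)
    then show ?thesis using S by (auto simp: card_1_singleton_iff)
  qed
  then obtain g where g: "g \<in> carrier G" "generate G {g} = carrier G" by blast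
  have sq: "g \<otimes>\<^bsub>G\<^esub> g = \<one>\<^bsub>G\<^esub>"
  proof (cases "g = \<one>\<^bsub>G\<^esub>")
    case False
    then have "ord g = 2" using G g by (simp add: elementary_abelian_two_group_def)
    then show ?thesis using pow_ord_eq_1[OF g(1)] g(1) by (simp add: numeral_2_eq_2)
  qed simp
  have "generated_by_tv_automaton 1 {0, 1 :: nat} G"
    using starts_chain_involution[OF g(1) sq] generate_involution[OF g(1) sq] g
    by (intro generated_by_tv_automaton_if_starts_chain[of _ _ "{g}"] comm_group_axioms) auto
  then show "G \<in> TVA 1" by (simp add: TVA_def comm_group_axioms)
qed

theorem TVA_gt_1:
  assumes "n > 1"
  shows "(TVA n :: 'a monoid set) = AB2 n"
proof (intro equalityI subsetI)
  fix G :: "'a monoid" assume "G \<in> TVA n"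
  then have G: "comm_group G" "generated_by_tv_automaton n {0, 1 :: nat} G" by (auto simp: TVA_def)
  interpret comm_group G by fact
  obtain S where S: "finite S" "card S \<le> n" "S \<subseteq> carrier G" "generate G S = carrier G"
    using generated_by_tv_automatonD(1)[OF group_axioms G(2)] by auto
  have "two_group (torsion_part G)"
    unfolding two_group_torsion_part_iff[OF G(1)] using generated_by_tv_automatonD(2)[OF group_axioms G(2)] by blast
  then show "G \<in> AB2 n" using group_rank_le[OF S(1,3,4)] S(2) G(1) by (simp add: AB2_def)
next
  fix G :: "'a monoid" assume "G \<in> AB2 n"
  then have G: "comm_group G" "two_group (torsion_part G)"
    and r: "finitely_generated G" "group_rank G \<le> n" by (auto simp: AB2_def)
  interpret comm_group G by fact
  obtain S where S: "finite S" "S \<subseteq> carrier G" "card S \<le> n" "generate G S = carrier G"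
    using group_rank_witness[OF r] by blast
  obtain h where "bij_betw h {..<card S} S"
    using ex_bij_betw_nat_finite[OF S(1)] by (auto simp: atLeast0LessThan)
  then have h: "h ` {..<card S} = S" by (simp add: bij_betw_def)
  \<comment> \<open>Padding with the identity turns \<open>S\<close> into a generating tuple of
    length exactly \<open>n\<close>.\<close>
  define f where "f = (\<lambda>i. if i < card S then h i else \<one>\<^bsub>G\<^esub>)"
  have f: "range f \<subseteq> carrier G" using h S(2) by (auto simp: f_def)
  have "S \<subseteq> f ` {..<n}"
  proof
    fix x assume "x \<in> S"
    then obtain i where "i < card S" "x = h i" using h by auto
    then show "x \<in> f ` {..<n}" using S(3) by (intro image_eqI[of _ _ i]) (auto simp: f_def)
  qed
  then have "carrier G \<subseteq> int_span n f"
    using mono_generate[of S "f ` {..<n}"] S(4) generate_eq_int_span[OF f] by simp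
  then have "int_span n f = carrier G" using int_span_closed[OF f] by blast
  then have "\<exists>E. starts_chain n E (carrier G) \<and> generate G E = carrier G"
    using G(2) assms f by (intro starts_chain_if_torsion_two_primary) (auto simp: torsion_two_primary_iff[OF G(1)])
  then have "generated_by_tv_automaton n {0, 1 :: nat} G"
    using generated_by_tv_automaton_if_starts_chain[OF G(1)] by blast
  then show "G \<in> TVA n" using G(1) by (simp add: TVA_def)
qed

theorem theorem1:
  shows "(TVA 1 :: 'a monoid set) = EA2 1 \<and> (\<forall>n::nat. n > 1 \<longrightarrow> (TVA n :: 'a monoid set) = AB2 n)"
  using TVA_1 TVA_gt_1 by blast

end
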